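(* Let $k\ge3$ be odd and let $n,B\in\mathbb{N}$ with $n\ge kB$ and $k\le B$; let $f_j=1/j$ for $j\in[n]$. Let $h_1,\dots,h_k:[n]\to[B]$ and $s_1,\dots,s_k:[n]\to\{-1,1\}$ be independent, truly (uniformly) random functions. For $i\in[n]$ define $$\tilde f_i=\mathrm{median}_{\ell\in[k]}\left(s_\ell(i)\sum_{j\in[n]}[h_\ell(j)=h_\ell(i)]\,s_\ell(j)f_j\right).$$ Then for every $i\in[n]$, $$\mathbb{E}[|\tilde f_i-f_i|]=\Omega\left(\frac{1}{B\sqrt k\log k}\right)\quad\text{and}\quad\mathbb{E}[|\tilde f_i-f_i|]=O\left(\frac{1}{B\sqrt k}\right),$$ with absolute implied constants.
   Context: $[E]$ denotes the indicator of the event $E$. For odd $k$, the median of $k$ real numbers is the middle value after sorting. *)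

theory Defs
  imports "HOL-Probability.Probability"
begin

text \<open>Meant for lists of odd length, where this is the middle entry after sorting.\<close>

definition median :: "real list \<Rightarrow> real" where
  "median xs = sort xs ! (length xs div 2)"

definition zipf_freq :: "nat \<Rightarrow> real" where
  "zipf_freq j = 1 / real j"

text \<open>
  The joint law of independent hash functions \<open>h 1, \<dots>, h k\<close>, each uniform on all functions
  from \<open>{1..n}\<close> to \<open>{1..B}\<close>, and sign functions \<open>s 1, \<dots>, s k\<close>, each uniform on all functions
  from \<open>{1..n}\<close> to \<open>{-1, 1}\<close>; all \<open>2 * k\<close> of them are jointly independent.
  The second argument of \<open>Pi_pmf\<close> is a dummy value taken outside \<open>{1..k}\<close>.
\<close>

definition sketch_pmf ::
    "nat \<Rightarrow> nat \<Rightarrow> nat \<Rightarrow> ((nat \<Rightarrow> nat \<Rightarrow> nat) \<times> (nat \<Rightarrow> nat \<Rightarrow> real)) pmf" where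
  "sketch_pmf k n B =
     pair_pmf
       (Pi_pmf {1..k} undefined (\<lambda>_. pmf_of_set ({1..n} \<rightarrow>\<^sub>E {1..B})))
       (Pi_pmf {1..k} undefined (\<lambda>_. pmf_of_set ({1..n} \<rightarrow>\<^sub>E {-1, 1})))"

definition count_sketch_estimate ::
    "(nat \<Rightarrow> real) \<Rightarrow> nat \<Rightarrow> nat \<Rightarrow> (nat \<Rightarrow> nat \<Rightarrow> nat) \<Rightarrow> (nat \<Rightarrow> nat \<Rightarrow> real) \<Rightarrow> nat \<Rightarrow> real" where
  "count_sketch_estimate f k n h s i =
     median (map (\<lambda>l. s l i * (\<Sum>j\<in>{1..n}. of_bool (h l j = h l i) * s l j * f j)) [1..<Suc k])"

definition expected_error :: "nat \<Rightarrow> nat \<Rightarrow> nat \<Rightarrow> nat \<Rightarrow> real" where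
  "expected_error k n B i =
     measure_pmf.expectation (sketch_pmf k n B)
       (\<lambda>(h, s). \<bar>count_sketch_estimate zipf_freq k n h s i - zipf_freq i\<bar>)"

end

theory Submission
  imports Defs
begin

text \<open>
  Subtracting \<open>zipf_freq i\<close> turns the error into the absolute value of the median of \<open>k\<close>
  independent copies of \<open>X = (\<Sum>j\<noteq>i. w\<^sub>j / j)\<close>, where \<open>w\<^sub>j\<close> is a uniform sign with probability
  \<open>1 / B\<close> and zero otherwise. Everything follows from the mass of \<open>X\<close> near \<open>0\<close> and its tail.

  Upper bound. Each \<open>w\<^sub>j\<close> is a difference of two independent Bernoulli variables, so \<open>X = Y - Y'\<close>
  with \<open>Y\<close>, \<open>Y'\<close> i.i.d.; since \<open>Y\<close> lies in a window of length \<open>O(1 / B)\<close> with constant probability,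
  the pigeonhole principle gives \<open>P(\<bar>X\<bar> \<le> t) \<ge> c B t\<close> for \<open>t \<le> 1 / B\<close>. Together with
  \<open>P(\<bar>X\<bar> > t) \<le> 3 / (B t)\<close> this bounds the probability that the median exceeds \<open>t\<close> by
  \<open>C / (k B\<^sup>2 t\<^sup>2)\<close>, for all \<open>t > 0\<close>.

  Lower bound. For large \<open>k\<close> about \<open>ln k\<close> of the items \<open>j\<close> in a block \<open>(N, 2 N]\<close> with
  \<open>N \<approx> B ln k\<close> collide with \<open>i\<close>, except with probability \<open>O(1 / k)\<close>. Their positions are spread out,
  so \<open>P(\<bar>X\<bar> \<le> t) = O(1 / k + B t ln k)\<close>, which is below \<open>1 / (48 sqrt k)\<close> for
  \<open>t\<close> of order \<open>1 / (B sqrt k ln k)\<close>. So few rows have \<open>\<bar>X\<bar> \<le> t\<close> that the fluctuation of the signs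
  of the other rows decides the median. For bounded \<open>k\<close> all rows exceed \<open>1 / (2 B)\<close> with constant
  probability.
\<close>

section \<open>Expectations over finitely supported products\<close>

abbreviation "E \<equiv> measure_pmf.expectation"
abbreviation "Pr \<equiv> measure_pmf.prob"

lemma prob_conv_expectation:
  "Pr p {x. P x} = E p (\<lambda>x. of_bool (P x))"
proof -
  have "(\<lambda>x. of_bool (P x)) = (indicator {x. P x} :: _ \<Rightarrow> real)"
    by (auto simp: indicator_def)
  thus ?thesis by simp
qed

lemma expectation_mono_finite:
  fixes f g :: "'a \<Rightarrow> real"
  assumes "finite (set_pmf p)" "\<And>x. x \<in> set_pmf p \<Longrightarrow> f x \<le> g x"
  shows "E p f \<le> E p g"
  using assms by (intro integral_mono_AE integrable_measure_pmf_finite AE_pmfI)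

lemma prob_mono_pmf:
  assumes "\<And>x. x \<in> set_pmf p \<Longrightarrow> P x \<Longrightarrow> Q x"
  shows "Pr p {x. P x} \<le> Pr p {x. Q x}"
proof -
  have "Pr p {x. P x} = Pr p ({x. P x} \<inter> set_pmf p)" by (simp add: measure_Int_set_pmf)
  also have "\<dots> \<le> Pr p {x. Q x}"
    using assms by (intro measure_pmf.finite_measure_mono) auto
  finally show ?thesis .
qed

lemma prob_disj_le: "Pr p {x. P x \<or> Q x} \<le> Pr p {x. P x} + Pr p {x. Q x}"
  unfolding Collect_disj_eq by (rule measure_Un_le) auto

lemma prob_Ex_le:
  assumes "finite A"
  shows "Pr p {x. \<exists>a\<in>A. P a x} \<le> (\<Sum>a\<in>A. Pr p {x. P a x})"
proof -
  have "{x. \<exists>a\<in>A. P a x} = (\<Union>a\<in>A. {x. P a x})" by auto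
  thus ?thesis
    using assms by (simp add: measure_pmf.finite_measure_subadditive_finite)
qed

lemma expectation_pair_finite:
  fixes F :: "'a \<times> 'b \<Rightarrow> real"
  assumes "finite (set_pmf M)" "finite (set_pmf N)"
  shows "E (pair_pmf M N) F = E M (\<lambda>a. E N (\<lambda>b. F (a, b)))"
proof -
  have "E (pair_pmf M N) F = (\<Sum>z\<in>set_pmf M \<times> set_pmf N. F z * pmf (pair_pmf M N) z)"
    using assms by (intro integral_measure_pmf_real) auto
  also have "\<dots> = (\<Sum>a\<in>set_pmf M. \<Sum>b\<in>set_pmf N. F (a, b) * (pmf M a * pmf N b))"
    by (auto simp: sum.cartesian_product pmf_pair intro!: sum.cong)
  also have "\<dots> = (\<Sum>a\<in>set_pmf M. (\<Sum>b\<in>set_pmf N. F (a, b) * pmf N b) * pmf M a)"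
    by (simp add: sum_distrib_left sum_distrib_right mult_ac)
  also have "\<dots> = (\<Sum>a\<in>set_pmf M. E N (\<lambda>b. F (a, b)) * pmf M a)"
    using assms by (intro sum.cong refl arg_cong2[of _ _ _ _ "(*)"] integral_measure_pmf_real[symmetric]) auto
  also have "\<dots> = E M (\<lambda>a. E N (\<lambda>b. F (a, b)))"
    using assms by (intro integral_measure_pmf_real[symmetric]) auto
  finally show ?thesis .
qed

lemma prob_pair_Times:
  assumes "finite (set_pmf M)" "finite (set_pmf N)"
  shows "Pr (pair_pmf M N) {z. P (fst z) \<and> Q (snd z)} = Pr M {a. P a} * Pr N {b. Q b}"
proof -
  have "Pr (pair_pmf M N) {z. P (fst z) \<and> Q (snd z)} =
      E M (\<lambda>a. E N (\<lambda>b. of_bool (P a) * of_bool (Q b)))"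
    by (simp add: prob_conv_expectation expectation_pair_finite assms of_bool_conj)
  thus ?thesis by (simp add: prob_conv_expectation)
qed

lemma finite_set_Pi_pmf:
  assumes "finite A" "\<And>x. x \<in> A \<Longrightarrow> finite (set_pmf (p x))"
  shows "finite (set_pmf (Pi_pmf A d p))"
  using assms by (auto simp: set_Pi_pmf)

lemma expectation_Pi_insert:
  fixes F :: "('a \<Rightarrow> 'b) \<Rightarrow> real"
  assumes "finite A" "x \<notin> A" "\<And>y. y \<in> insert x A \<Longrightarrow> finite (set_pmf (p y))"
  shows "E (Pi_pmf (insert x A) d p) F = E (p x) (\<lambda>y. E (Pi_pmf A d p) (\<lambda>f. F (f(x := y))))"
  using assms by (simp add: Pi_pmf_insert case_prod_unfold expectation_pair_finite finite_set_Pi_pmf)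

lemma expectation_Pi_component:
  fixes F :: "'b \<Rightarrow> real"
  assumes "finite A" "x \<in> A"
  shows "E (Pi_pmf A d p) (\<lambda>f. F (f x)) = E (p x) F"
  using integral_map_pmf[of "\<lambda>f. f x" "Pi_pmf A d p" F] Pi_pmf_component[OF assms(1), of x d p] assms(2)
  by simp

lemma expectation_finite_linear:
  fixes f g :: "'a \<Rightarrow> real"
  assumes "finite (set_pmf p)"
  shows "E p (\<lambda>x. f x + g x) = E p f + E p g" "E p (\<lambda>x. f x - g x) = E p f - E p g"
  by (simp_all add: integrable_measure_pmf_finite[OF assms])

lemma expectation_finite_sum:
  fixes f :: "'b \<Rightarrow> 'a \<Rightarrow> real"
  assumes "finite (set_pmf p)"
  shows "E p (\<lambda>x. \<Sum>i\<in>A. f i x) = (\<Sum>i\<in>A. E p (f i))"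
  by (simp add: Bochner_Integration.integral_sum integrable_measure_pmf_finite[OF assms])

section \<open>Moments of sums of independent centred variables\<close>

lemma expectation_sum_zero_Pi:
  fixes g :: "'a \<Rightarrow> 'b \<Rightarrow> real"
  assumes "finite A" "\<And>x. x \<in> A \<Longrightarrow> finite (set_pmf (p x))" "\<And>x. x \<in> A \<Longrightarrow> E (p x) (g x) = 0"
  shows "E (Pi_pmf A d p) (\<lambda>f. \<Sum>x\<in>A. g x (f x)) = 0"
  using assms by (simp add: expectation_finite_sum finite_set_Pi_pmf expectation_Pi_component)

lemma sum_fun_upd_other:
  assumes "x \<notin> A"
  shows "(\<Sum>z\<in>A. g z (if z = x then y else f z)) = (\<Sum>z\<in>A. g z (f z))"
  using assms by (intro sum.cong) auto

lemma expectation_sum_square_Pi: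
  fixes g :: "'a \<Rightarrow> 'b \<Rightarrow> real"
  assumes "finite A" "\<And>x. x \<in> A \<Longrightarrow> finite (set_pmf (p x))" "\<And>x. x \<in> A \<Longrightarrow> E (p x) (g x) = 0"
  shows "E (Pi_pmf A d p) (\<lambda>f. (\<Sum>x\<in>A. g x (f x))\<^sup>2) = (\<Sum>x\<in>A. E (p x) (\<lambda>y. (g x y)\<^sup>2))"
  using assms
proof (induction rule: finite_induct)
  case (insert x A)
  let ?P = "Pi_pmf A d p" let ?S = "\<lambda>f. \<Sum>z\<in>A. g z (f z)"
  have fin: "finite (set_pmf ?P)" "finite (set_pmf (p x))"
    using insert by (auto simp: finite_set_Pi_pmf)
  have z: "E ?P ?S = 0" using insert by (intro expectation_sum_zero_Pi) auto
  have "E (Pi_pmf (insert x A) d p) (\<lambda>f. (\<Sum>x\<in>insert x A. g x (f x))\<^sup>2)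
      = E (p x) (\<lambda>y. E ?P (\<lambda>f. (g x y + ?S f)\<^sup>2))"
    using insert by (subst expectation_Pi_insert) (simp_all add: sum_fun_upd_other)
  also have "\<dots> = E (p x) (\<lambda>y. E ?P (\<lambda>f. (g x y)\<^sup>2 + (2 * g x y * ?S f + (?S f)\<^sup>2)))"
    by (simp add: power2_sum algebra_simps)
  also have "\<dots> = E (p x) (\<lambda>y. (g x y)\<^sup>2 + E ?P (\<lambda>f. (?S f)\<^sup>2))"
    by (simp add: expectation_finite_linear fin z)
  also have "\<dots> = E (p x) (\<lambda>y. (g x y)\<^sup>2) + E ?P (\<lambda>f. (?S f)\<^sup>2)"
    by (simp add: expectation_finite_linear fin)
  finally show ?case using insert by simp
qed simp

text \<open>Let a summand \<open>g\<close> join a sum \<open>S\<close> of \<open>n\<close> terms.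
  The terms \<open>4 g^3 S\<close> and \<open>4 g S^3\<close> have mean zero because
  \<open>S\<close> and \<open>g\<close> do, and \<open>6 g^2 S^2 + g^4\<close> adds at most
  \<open>6 n + 1\<close>, which is below \<open>3 (n + 1)^2 - 3 n^2\<close>.\<close>

lemma expectation_sum_fourth_Pi:
  fixes g :: "'a \<Rightarrow> 'b \<Rightarrow> real"
  assumes "finite A" "\<And>x. x \<in> A \<Longrightarrow> finite (set_pmf (p x))" "\<And>x. x \<in> A \<Longrightarrow> E (p x) (g x) = 0"
    "\<And>x. x \<in> A \<Longrightarrow> E (p x) (\<lambda>y. (g x y) ^ 3) = 0" "\<And>x y. x \<in> A \<Longrightarrow> \<bar>g x y\<bar> \<le> 1"
  shows "E (Pi_pmf A d p) (\<lambda>f. (\<Sum>x\<in>A. g x (f x)) ^ 4) \<le> 3 * (real (card A))\<^sup>2"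
  using assms
proof (induction rule: finite_induct)
  case (insert x A)
  let ?P = "Pi_pmf A d p" let ?S = "\<lambda>f. \<Sum>z\<in>A. g z (f z)"
  have fin: "finite (set_pmf ?P)" "finite (set_pmf (p x))"
    using insert by (auto simp: finite_set_Pi_pmf)
  have z: "E ?P ?S = 0" using insert by (intro expectation_sum_zero_Pi) auto
  have sq: "E (p y) (\<lambda>v. (g y v)\<^sup>2) \<le> 1" if "y \<in> insert x A" for y
    using expectation_mono_finite[of "p y" "\<lambda>v. (g y v)\<^sup>2" "\<lambda>_. 1"] insert.prems that
    by (auto simp: abs_square_le_1)
  have S2: "E ?P (\<lambda>f. (?S f)\<^sup>2) = (\<Sum>x\<in>A. E (p x) (\<lambda>y. (g x y)\<^sup>2))"
    using insert by (intro expectation_sum_square_Pi) auto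
  also have "\<dots> \<le> (\<Sum>x\<in>A. 1)" using sq by (intro sum_mono) auto
  finally have S2le: "E ?P (\<lambda>f. (?S f)\<^sup>2) \<le> card A" by simp
  have S20: "0 \<le> E ?P (\<lambda>f. (?S f)\<^sup>2)" by simp
  have g4: "E (p x) (\<lambda>y. (g x y)^4) \<le> 1"
    using expectation_mono_finite[of "p x" "\<lambda>v. (g x v)^4" "\<lambda>_. 1"] insert.prems(1)
      power_le_one[OF abs_ge_zero insert.prems(4)[of x], of _ 4]
    by simp
  have e: "(a + b) ^ 4 = (a ^ 4 + 4 * a ^ 3 * b) + (6 * a\<^sup>2 * b\<^sup>2 + (4 * a * b ^ 3 + b ^ 4))"
    for a b :: real by algebra
  have "E (Pi_pmf (insert x A) d p) (\<lambda>f. (\<Sum>x\<in>insert x A. g x (f x)) ^ 4)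
      = E (p x) (\<lambda>y. E ?P (\<lambda>f. (g x y + ?S f) ^ 4))"
    using insert by (subst expectation_Pi_insert) (simp_all add: sum_fun_upd_other)
  also have "\<dots> = E (p x) (\<lambda>y. g x y ^ 4 + (6 * (g x y)\<^sup>2 * E ?P (\<lambda>f. (?S f)\<^sup>2)
      + (4 * g x y * E ?P (\<lambda>f. ?S f ^ 3) + E ?P (\<lambda>f. ?S f ^ 4))))"
    by (simp only: e) (simp add: expectation_finite_linear fin z)
  also have "\<dots> = E (p x) (\<lambda>y. g x y ^ 4) + 6 * E (p x) (\<lambda>y. (g x y)\<^sup>2) * E ?P (\<lambda>f. (?S f)\<^sup>2)
      + E ?P (\<lambda>f. ?S f ^ 4)"
    using insert.prems(2)[of x] by (simp add: expectation_finite_linear fin)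
  also have "\<dots> \<le> 1 + 6 * 1 * real (card A) + 3 * (real (card A))\<^sup>2"
    using g4 S2le S20 sq[of x] insert by (intro add_mono mult_mono) auto
  also have "\<dots> \<le> 3 * (real (card (insert x A)))\<^sup>2"
    using insert by (simp add: power2_eq_square algebra_simps)
  finally show ?case by simp
qed simp

lemma Chebyshev_pmf:
  fixes f :: "'a \<Rightarrow> real"
  assumes "finite (set_pmf p)" "0 < a" "E p (\<lambda>x. (f x)\<^sup>2) \<le> v"
  shows "Pr p {x. a \<le> \<bar>f x\<bar>} \<le> v / a\<^sup>2"
proof -
  have "Pr p {x. a \<le> \<bar>f x\<bar>} \<le> E p (\<lambda>x. (f x)\<^sup>2 / a\<^sup>2)"
    unfolding prob_conv_expectation
  proof (intro expectation_mono_finite assms(1))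
    fix x
    have "a \<le> \<bar>f x\<bar> \<Longrightarrow> 1 \<le> (f x)\<^sup>2 / a\<^sup>2"
      using assms(2) power_mono[of a "\<bar>f x\<bar>" 2] by simp
    thus "of_bool (a \<le> \<bar>f x\<bar>) \<le> (f x)\<^sup>2 / a\<^sup>2" by auto
  qed
  also have "\<dots> \<le> v / a\<^sup>2" using assms(3) by (simp add: divide_right_mono)
  finally show ?thesis .
qed

lemma Markov_pmf:
  fixes f :: "'a \<Rightarrow> real"
  assumes "finite (set_pmf p)" "0 < a" "\<And>x. 0 \<le> f x"
  shows "Pr p {x. a \<le> f x} \<le> E p f / a"
proof -
  have "Pr p {x. a \<le> f x} \<le> E p (\<lambda>x. f x / a)"
    unfolding prob_conv_expectation using assms
    by (intro expectation_mono_finite) (auto simp: of_bool_def)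
  thus ?thesis by simp
qed

section \<open>The median and dyadic tails\<close>

text \<open>In a sorted list the entries above \<open>t\<close> form a suffix and those below
  \<open>t\<close> a prefix, so the entry at \<open>m\<close> tells whether that suffix or prefix
  reaches \<open>m\<close>.\<close>

lemma sorted_nth_less_iff:
  fixes ys :: "real list"
  assumes "sorted ys" "m < length ys"
  shows "t < ys ! m \<longleftrightarrow> length ys - m \<le> length (filter (\<lambda>y. t < y) ys)"
    and "ys ! m < t \<longleftrightarrow> m < length (filter (\<lambda>y. y < t) ys)"
proof -
  let ?A = "{i. i < length ys \<and> t < ys ! i}" and ?B = "{i. i < length ys \<and> ys ! i < t}"
  have mono: "ys ! i \<le> ys ! j" if "i \<le> j" "j < length ys" for i j
    using assms(1) that by (rule sorted_nth_mono)
  have A: "length (filter (\<lambda>y. t < y) ys) = card ?A"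
    and B: "length (filter (\<lambda>y. y < t) ys) = card ?B"
    by (simp_all add: length_filter_conv_card)
  show "t < ys ! m \<longleftrightarrow> length ys - m \<le> length (filter (\<lambda>y. t < y) ys)"
  proof
    assume "t < ys ! m"
    hence "{m..<length ys} \<subseteq> ?A" using mono by (auto intro: less_le_trans)
    from card_mono[OF _ this] show "length ys - m \<le> length (filter (\<lambda>y. t < y) ys)"
      using A by simp
  next
    assume le: "length ys - m \<le> length (filter (\<lambda>y. t < y) ys)"
    show "t < ys ! m"
    proof (rule ccontr)
      assume n: "\<not> t < ys ! m"
      have "?A \<subseteq> {m<..<length ys}"
      proof
        fix i assume "i \<in> ?A"
        thus "i \<in> {m<..<length ys}" using n mono[of i m] assms(2) by (cases "i \<le> m") auto
      qed
      from card_mono[OF _ this] show False using A le assms(2) by simp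
    qed
  qed
  show "ys ! m < t \<longleftrightarrow> m < length (filter (\<lambda>y. y < t) ys)"
  proof
    assume "ys ! m < t"
    hence "{..m} \<subseteq> ?B" using mono assms(2) by (auto intro: le_less_trans)
    from card_mono[OF _ this] show "m < length (filter (\<lambda>y. y < t) ys)"
      using B by simp
  next
    assume le: "m < length (filter (\<lambda>y. y < t) ys)"
    show "ys ! m < t"
    proof (rule ccontr)
      assume n: "\<not> ys ! m < t"
      have "?B \<subseteq> {..<m}"
      proof
        fix i assume "i \<in> ?B"
        thus "i \<in> {..<m}" using n mono[of m i] assms(2) by (cases "m \<le> i") auto
      qed
      from card_mono[OF _ this] show False using B le by simp
    qed
  qed
qed

lemma length_filter_sort: "length (filter P (sort xs)) = length (filter P xs)"
  by (metis mset_filter mset_sort size_mset)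

text \<open>For length \<open>2 m + 1\<close> both counts of the sorted-list criterion become
  \<open>m + 1\<close>, a strict majority. Tail events of the median thus become events about counts
  of rows.\<close>

lemma median_less_iff:
  assumes "odd (length xs)"
  shows "t < median xs \<longleftrightarrow> length xs < 2 * length (filter (\<lambda>y. t < y) xs)"
    and "median xs < t \<longleftrightarrow> length xs < 2 * length (filter (\<lambda>y. y < t) xs)"
proof -
  obtain m where m: "length xs = 2 * m + 1" using assms by (auto elim: oddE)
  show "t < median xs \<longleftrightarrow> length xs < 2 * length (filter (\<lambda>y. t < y) xs)"
    using sorted_nth_less_iff(1)[of "sort xs" m t] m
    by (auto simp: median_def length_filter_sort)
  show "median xs < t \<longleftrightarrow> length xs < 2 * length (filter (\<lambda>y. y < t) xs)"
    using sorted_nth_less_iff(2)[of "sort xs" m t] m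
    by (auto simp: median_def length_filter_sort)
qed

lemma median_map_add:
  assumes "xs \<noteq> []"
  shows "median (map ((+) c) xs) = c + median xs"
proof -
  have "sort (map ((+) c) xs) = map ((+) c) (sort xs)"
    by (rule properties_for_sort) (auto simp: sorted_map intro: sorted_wrt_mono_rel[OF _ sorted_sort])
  thus ?thesis using assms by (simp add: median_def)
qed

definition med :: "nat \<Rightarrow> (nat \<Rightarrow> real) \<Rightarrow> real" where
  "med k x = median (map x [1..<Suc k])"

text \<open>A real sum of indicators, so that the moment bounds for sums over \<open>Pi_pmf\<close>
  apply to it directly.\<close>

definition rows_count :: "nat \<Rightarrow> (real \<Rightarrow> bool) \<Rightarrow> (nat \<Rightarrow> real) \<Rightarrow> real" where
  "rows_count k P x = (\<Sum>l\<in>{1..k}. of_bool (P (x l)))"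

lemma length_filter_map_upt:
  "real (length (filter P (map x [1..<Suc k]))) = rows_count k P x"
proof (induction k)
  case (Suc k)
  have "[1..<Suc (Suc k)] = [1..<Suc k] @ [Suc k]" by simp
  thus ?case using Suc by (simp add: rows_count_def del: upt_Suc)
qed (simp add: rows_count_def)

lemma med_less_iff:
  assumes "odd k"
  shows "t < med k x \<longleftrightarrow> real k < 2 * rows_count k (\<lambda>y. t < y) x"
    and "med k x < t \<longleftrightarrow> real k < 2 * rows_count k (\<lambda>y. y < t) x"
  using median_less_iff[of "map x [1..<Suc k]" t] assms
  unfolding med_def length_filter_map_upt[symmetric]
  by (simp_all del: upt_Suc flip: of_nat_less_iff[where 'a = real])

lemma med_add_const:
  assumes "1 \<le> k"
  shows "med k (\<lambda>l. c + x l) = c + med k x"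
  using median_map_add[of "map x [1..<Suc k]" c] assms
  by (simp add: med_def o_def del: upt_Suc)

text \<open>Once \<open>y\<close> exceeds \<open>2 ^ N * a\<close>, all indicators up to level
  \<open>N\<close> equal 1, and \<open>a\<close> plus their geometric sum is exactly
  \<open>2 ^ Suc N * a\<close>.\<close>

lemma le_dyadic_sum:
  fixes a y :: real
  assumes "0 \<le> a" "y \<le> 2 ^ N * a"
  shows "y \<le> a + (\<Sum>m<N. 2 ^ m * a * of_bool (2 ^ m * a < y))"
  using assms(2)
proof (induction N)
  case (Suc N)
  show ?case
  proof (cases "y \<le> 2 ^ N * a")
    case True
    with Suc.IH show ?thesis using assms(1) by simp
  next
    case False
    have *: "2 ^ m * a < y" if "m < Suc N" for m
    proof -
      have "2 ^ m * a \<le> 2 ^ N * a" using that assms(1) by (intro mult_right_mono power_increasing) auto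
      thus ?thesis using False by simp
    qed
    have "(\<Sum>m<Suc N. 2 ^ m * a * of_bool (2 ^ m * a < y)) = (\<Sum>m<Suc N. 2 ^ m) * a"
      unfolding sum_distrib_right using * by (intro sum.cong) auto
    also have "(\<Sum>m<Suc N. 2 ^ m) = (2 ^ Suc N - 1 :: real)"
      using mask_eq_sum_exp[of "Suc N", where 'a = int] geometric_sum[of "2::real" "Suc N"] by simp
    finally show ?thesis using Suc.prems by (simp add: algebra_simps)
  qed
qed simp

text \<open>A discrete form of integrating the tail: the level \<open>2 ^ m * a\<close> contributes
  at most \<open>K * a / 2 ^ m\<close>, and these sum to at most \<open>2 * K * a\<close>. Finite
  support bounds \<open>Y\<close>, so finitely many levels suffice.\<close>

lemma expectation_le_of_square_tail:
  fixes Y :: "'a \<Rightarrow> real"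
  assumes fin: "finite (set_pmf p)" and a: "0 < a" and K: "0 \<le> K"
    and tail: "\<And>t. 0 < t \<Longrightarrow> Pr p {x. t < Y x} \<le> K * a\<^sup>2 / t\<^sup>2"
  shows "E p Y \<le> (1 + 2 * K) * a"
proof -
  define M where "M = Max (Y ` set_pmf p)"
  have M: "Y x \<le> M" if "x \<in> set_pmf p" for x using fin that by (simp add: M_def)
  obtain N :: nat where N: "M / a < 2 ^ N" using real_arch_pow[of 2] by auto
  have "E p Y \<le> E p (\<lambda>x. a + (\<Sum>m<N. 2 ^ m * a * of_bool (2 ^ m * a < Y x)))"
  proof (intro expectation_mono_finite fin le_dyadic_sum)
    fix x assume "x \<in> set_pmf p"
    from M[OF this] N a show "Y x \<le> 2 ^ N * a" by (simp add: divide_less_eq)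
  qed (use a in simp)
  also have "\<dots> = a + (\<Sum>m<N. 2 ^ m * a * Pr p {x. 2 ^ m * a < Y x})"
    unfolding expectation_finite_linear[OF fin] expectation_finite_sum[OF fin] prob_conv_expectation by simp
  also have "(\<Sum>m<N. 2 ^ m * a * Pr p {x. 2 ^ m * a < Y x}) \<le> (\<Sum>m<N. K * a * (1 / 2) ^ m)"
  proof (intro sum_mono)
    fix m
    have "2 ^ m * a * Pr p {x. 2 ^ m * a < Y x} \<le> 2 ^ m * a * (K * a\<^sup>2 / (2 ^ m * a)\<^sup>2)"
      using a by (intro mult_left_mono tail) auto
    also have "\<dots> = K * a * (1 / 2) ^ m"
      using a by (simp add: power2_eq_square power_divide field_simps)
    finally show "2 ^ m * a * Pr p {x. 2 ^ m * a < Y x} \<le> K * a * (1 / 2) ^ m" .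
  qed
  also have "(\<Sum>m<N. K * a * (1 / 2) ^ m) = K * a * (2 - 2 * (1 / 2) ^ N)"
    by (simp add: geometric_sum[of "1/2::real"] flip: sum_distrib_left)
  also have "\<dots> \<le> K * a * 2" using K a by (intro mult_left_mono) auto
  finally show ?thesis by (simp add: algebra_simps)
qed

section \<open>The noise in one row\<close>

definition sign_pmf :: "real pmf" where "sign_pmf = pmf_of_set {-1, 1}"

text \<open>The law of \<open>of_bool (h j = h i) * s i * s j\<close> for one item \<open>j\<close>,
  where \<open>q = 1 / B\<close> is the collision probability.\<close>

definition coll_pmf :: "real \<Rightarrow> real pmf" where
  "coll_pmf q = bernoulli_pmf q \<bind> (\<lambda>b. map_pmf (\<lambda>e. of_bool b * e) sign_pmf)"

definition row_pmf :: "real \<Rightarrow> nat set \<Rightarrow> (nat \<Rightarrow> real) pmf" where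
  "row_pmf q J = Pi_pmf J 0 (\<lambda>_. coll_pmf q)"

definition row_val :: "nat set \<Rightarrow> (nat \<Rightarrow> real) \<Rightarrow> real" where
  "row_val J w = (\<Sum>j\<in>J. w j / real j)"

definition noise_pmf :: "real \<Rightarrow> nat set \<Rightarrow> real pmf" where
  "noise_pmf q J = map_pmf (row_val J) (row_pmf q J)"

lemma set_sign_pmf [simp]: "set_pmf sign_pmf = {-1, 1}"
  by (simp add: sign_pmf_def)

lemma sign_pmf_mult:
  assumes "a \<in> {-1, 1}"
  shows "map_pmf ((*) a) sign_pmf = sign_pmf"
  unfolding sign_pmf_def using assms by (subst map_pmf_of_set_inj) (auto simp: inj_on_def insert_commute)

lemma bernoulli_of_eq:
  assumes "finite S" "a \<in> S"
  shows "map_pmf (\<lambda>b. b = a) (pmf_of_set S) = bernoulli_pmf (1 / card S)"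
proof (rule pmf_eqI)
  fix c
  have c1: "1 \<le> real (card S)" using assms by (metis One_nat_def Suc_leI card_gt_0_iff empty_iff of_nat_1 of_nat_le_iff)
  have T: "pmf (map_pmf (\<lambda>b. b = a) (pmf_of_set S)) True = 1 / card S"
  proof -
    have "(\<lambda>b. b = a) -` {True} = {a}" by auto
    moreover have "pmf (pmf_of_set S) a = 1 / card S" using assms by (subst pmf_of_set) auto
    ultimately show ?thesis by (simp add: pmf_map measure_pmf_single)
  qed
  show "pmf (map_pmf (\<lambda>b. b = a) (pmf_of_set S)) c = pmf (bernoulli_pmf (1 / card S)) c"
    using T c1 by (cases c) (simp_all add: pmf_False_conv_True)
qed

lemma pmf_of_set_PiE_conv_Pi_pmf:
  assumes "finite A" "finite S" "S \<noteq> {}"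
  shows "pmf_of_set (A \<rightarrow>\<^sub>E S) = Pi_pmf A undefined (\<lambda>_. pmf_of_set S)"
proof -
  have "PiE_dflt A undefined (\<lambda>_. S) = A \<rightarrow>\<^sub>E S"
    by (auto simp: PiE_dflt_def PiE_def extensional_def)
  thus ?thesis using Pi_pmf_of_set[of A "\<lambda>_. S" undefined] assms by simp
qed

text \<open>Combining two independent product families coordinate by coordinate gives a product
  family again. This merges hash and sign functions into one product, over the items of a row and
  then over the rows. Outside \<open>A\<close> the value is the default \<open>d\<close>.\<close>

lemma Pi_pmf_product_of_pairs:
  assumes "finite A" 
  shows "(Pi_pmf A d1 p \<bind> (\<lambda>h. map_pmf (\<lambda>s l. if l \<in> A then F l (h l) (s l) else d) (Pi_pmf A d2 q)))
     = Pi_pmf A d (\<lambda>l. p l \<bind> (\<lambda>h. map_pmf (F l h) (q l)))"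
  by (simp add: map_pmf_def assms Pi_pmf_bind[where d' = d1] Pi_pmf_bind[where d' = d2])

text \<open>All values of \<open>h i\<close> and \<open>s i\<close> give the same conditional law, so both can be integrated out.\<close>
lemma row_law:
  fixes B :: nat
  assumes "i \<in> {1..n}" "1 \<le> B"
  defines "J \<equiv> {1..n} - {i}"
  shows "(pmf_of_set ({1..n} \<rightarrow>\<^sub>E {1..B}) \<bind> (\<lambda>h. map_pmf (\<lambda>s. \<Sum>j\<in>J. of_bool (h j = h i) * s i * s j / real j)
        (pmf_of_set ({1..n} \<rightarrow>\<^sub>E {-1, 1})))) = noise_pmf (1 / B) J"
proof -
  let ?U = "pmf_of_set {1..B}"
  have I: "{1..n} = insert i J" "i \<notin> J" "finite J" using assms(1) by (auto simp: J_def)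
  have U: "finite {1..B}" "{1..B} \<noteq> {}" using assms(2) by auto
  have H: "pmf_of_set ({1..n} \<rightarrow>\<^sub>E {1..B}) =
      ?U \<bind> (\<lambda>a. map_pmf (\<lambda>h. h(i := a)) (Pi_pmf J undefined (\<lambda>_. ?U)))"
    using I U by (simp add: pmf_of_set_PiE_conv_Pi_pmf Pi_pmf_insert' map_pmf_def)
  have S: "pmf_of_set ({1..n} \<rightarrow>\<^sub>E {-1, 1}) =
      sign_pmf \<bind> (\<lambda>a. map_pmf (\<lambda>h. h(i := a)) (Pi_pmf J undefined (\<lambda>_. sign_pmf)))"
    using I by (simp add: pmf_of_set_PiE_conv_Pi_pmf Pi_pmf_insert' map_pmf_def sign_pmf_def)
  \<comment> \<open>Here \<open>a\<close> and \<open>c\<close> stand for the values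
    \<open>h i\<close> and \<open>s i\<close>. A uniform sign absorbs the factor \<open>c\<close>,
    and \<open>h = a\<close> has probability \<open>1 / B\<close> for every
    \<open>a\<close>.\<close>
  have single: "?U \<bind> (\<lambda>h. map_pmf (\<lambda>s. of_bool (h = a) * c * s) sign_pmf) = coll_pmf (1 / B)"
    if "a \<in> {1..B}" "c \<in> {-1, 1}" for a and c :: real
  proof -
    have "map_pmf (\<lambda>s. of_bool (h = a) * c * s) sign_pmf =
        map_pmf (\<lambda>s. of_bool (h = a) * s) sign_pmf" for h
      using arg_cong[OF sign_pmf_mult[OF that(2)], of "map_pmf (\<lambda>s. of_bool (h = a) * s)"]
      by (simp add: map_pmf_comp mult.assoc)
    hence "?U \<bind> (\<lambda>h. map_pmf (\<lambda>s. of_bool (h = a) * c * s) sign_pmf) =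
        map_pmf (\<lambda>h. h = a) ?U \<bind> (\<lambda>b. map_pmf (\<lambda>s. of_bool b * s) sign_pmf)"
      by (simp add: bind_map_pmf)
    thus ?thesis using that bernoulli_of_eq[of "{1..B}" a] by (simp add: coll_pmf_def)
  qed
  have inner: "Pi_pmf J undefined (\<lambda>_. ?U) \<bind> (\<lambda>h. map_pmf (\<lambda>s. \<Sum>j\<in>J. of_bool (h j = a) * c * s j / real j)
      (Pi_pmf J undefined (\<lambda>_. sign_pmf))) = noise_pmf (1 / B) J"
    if "a \<in> {1..B}" "c \<in> {-1, 1}" for a and c :: real
  proof -
    have "row_pmf (1 / B) J = Pi_pmf J undefined (\<lambda>_. ?U) \<bind> (\<lambda>h. map_pmf
        (\<lambda>s l. if l \<in> J then of_bool (h l = a) * c * s l else 0) (Pi_pmf J undefined (\<lambda>_. sign_pmf)))"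
      unfolding Pi_pmf_product_of_pairs[OF I(3), where F = "\<lambda>_ h s. of_bool (h = a) * c * s"] row_pmf_def
      by (simp only: single[OF that])
    thus ?thesis
      by (simp add: noise_pmf_def map_bind_pmf map_pmf_comp row_val_def)
  qed
  have "pmf_of_set ({1..n} \<rightarrow>\<^sub>E {1..B}) \<bind> (\<lambda>h. map_pmf (\<lambda>s. \<Sum>j\<in>J. of_bool (h j = h i) * s i * s j / real j)
        (pmf_of_set ({1..n} \<rightarrow>\<^sub>E {-1, 1})))
     = ?U \<bind> (\<lambda>a. Pi_pmf J undefined (\<lambda>_. ?U) \<bind> (\<lambda>h. sign_pmf \<bind> (\<lambda>c. map_pmf
         (\<lambda>s. \<Sum>j\<in>J. of_bool ((h(i := a)) j = a) * c * (s(i := c)) j / real j) (Pi_pmf J undefined (\<lambda>_. sign_pmf)))))"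
    unfolding H S by (simp add: bind_map_pmf bind_assoc_pmf map_bind_pmf map_pmf_comp)
  also have "\<dots> = ?U \<bind> (\<lambda>a. Pi_pmf J undefined (\<lambda>_. ?U) \<bind> (\<lambda>h. sign_pmf \<bind> (\<lambda>c. map_pmf
         (\<lambda>s. \<Sum>j\<in>J. of_bool (h j = a) * c * s j / real j) (Pi_pmf J undefined (\<lambda>_. sign_pmf)))))"
  proof -
    have "(\<Sum>j\<in>J. of_bool ((h(i := a)) j = a) * c * (s(i := c)) j / real j) =
      (\<Sum>j\<in>J. of_bool (h j = a) * c * s j / real j)"
      for h :: "nat \<Rightarrow> nat" and a c and s :: "nat \<Rightarrow> real"
      using I by (intro sum.cong) auto
    thus ?thesis by (simp only:)
  qed
  \<comment> \<open>The draw of \<open>s i\<close> is moved before the other hash values, so that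
    \<open>inner\<close> applies with both \<open>a\<close> and \<open>c\<close> fixed.\<close>
  also have "\<dots> = ?U \<bind> (\<lambda>a. sign_pmf \<bind> (\<lambda>c. Pi_pmf J undefined (\<lambda>_. ?U) \<bind> (\<lambda>h. map_pmf
         (\<lambda>s. \<Sum>j\<in>J. of_bool (h j = a) * c * s j / real j) (Pi_pmf J undefined (\<lambda>_. sign_pmf)))))"
    by (subst bind_commute_pmf) (rule refl)
  also have "\<dots> = ?U \<bind> (\<lambda>a. sign_pmf \<bind> (\<lambda>c. noise_pmf (1 / B) J))"
    using U inner by (intro bind_pmf_cong refl) auto
  finally show ?thesis by simp
qed

lemma set_coll_pmf: "set_pmf (coll_pmf q) \<subseteq> {-1, 0, 1}"
  by (auto simp: coll_pmf_def)

lemma finite_set_coll_pmf [simp]: "finite (set_pmf (coll_pmf q))"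
  by (rule finite_subset[OF set_coll_pmf]) auto

lemma finite_set_row_pmf [simp]: "finite J \<Longrightarrow> finite (set_pmf (row_pmf q J))"
  by (simp add: row_pmf_def finite_set_Pi_pmf)

lemma finite_set_noise_pmf [simp]: "finite J \<Longrightarrow> finite (set_pmf (noise_pmf q J))"
  by (simp add: noise_pmf_def)

lemma expectation_coll_pmf:
  fixes F :: "real \<Rightarrow> real"
  assumes "0 \<le> q" "q \<le> 1"
  shows "E (coll_pmf q) F = (1 - q) * F 0 + q / 2 * (F 1 + F (-1))"
proof -
  have "coll_pmf q = map_pmf (\<lambda>(b, e). of_bool b * e) (pair_pmf (bernoulli_pmf q) sign_pmf)"
    by (simp add: coll_pmf_def pair_pmf_def map_pmf_def bind_assoc_pmf bind_return_pmf)
  hence "E (coll_pmf q) F = E (bernoulli_pmf q) (\<lambda>b. E sign_pmf (\<lambda>e. F (of_bool b * e)))"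
    by (simp add: case_prod_unfold expectation_pair_finite)
  moreover have "E sign_pmf G = (G 1 + G (-1)) / 2" for G :: "real \<Rightarrow> real"
    by (simp add: sign_pmf_def integral_pmf_of_set)
  ultimately show ?thesis using assms by (simp add: algebra_simps)
qed

text \<open>In each row the item \<open>i\<close> itself contributes
  \<open>s(i)^2 f_i = f_i\<close>, so every row is \<open>f_i\<close> plus noise, and the common
  shift passes through the median.\<close>

lemma expected_error_eq:
  assumes i: "i \<in> {1..n}" and B: "1 \<le> B" and k: "1 \<le> k"
  shows "expected_error k n B i =
    E (Pi_pmf {1..k} 0 (\<lambda>_. noise_pmf (1 / real B) ({1..n} - {i}))) (\<lambda>x. \<bar>med k x\<bar>)"
proof -
  let ?J = "{1..n} - {i}"
  let ?P = "pmf_of_set ({1..n} \<rightarrow>\<^sub>E {1..B})" and ?Q = "pmf_of_set ({1..n} \<rightarrow>\<^sub>E {-1, 1 :: real})"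
  define F where "F = (\<lambda>(h :: nat \<Rightarrow> nat) (s :: nat \<Rightarrow> real). \<Sum>j\<in>?J. of_bool (h j = h i) * s i * s j / real j)"
  \<comment> \<open>The value 0 outside \<open>{1..k}\<close> matches the default of the product law
    on the right-hand side.\<close>
  define G where "G = (\<lambda>h s l. if l \<in> {1..k} then F (h l) (s l) else 0)"
  have finQ: "finite ({1..n} \<rightarrow>\<^sub>E {-1, 1 :: real})" "({1..n} \<rightarrow>\<^sub>E {-1, 1 :: real}) \<noteq> {}"
    by (auto intro!: finite_PiE simp: PiE_eq_empty_iff)
  have "Pi_pmf {1..k} 0 (\<lambda>_. noise_pmf (1 / real B) ?J) =
      Pi_pmf {1..k} undefined (\<lambda>_. ?P) \<bind> (\<lambda>h. map_pmf (G h) (Pi_pmf {1..k} undefined (\<lambda>_. ?Q)))"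
    unfolding G_def Pi_pmf_product_of_pairs[OF finite_atLeastAtMost, where F = "\<lambda>_. F"]
    by (simp only: row_law[OF i B] F_def)
  also have "\<dots> = map_pmf (\<lambda>(h, s). G h s) (sketch_pmf k n B)"
    by (simp add: sketch_pmf_def pair_pmf_def map_pmf_def bind_assoc_pmf bind_return_pmf)
  finally have "E (Pi_pmf {1..k} 0 (\<lambda>_. noise_pmf (1 / real B) ?J)) (\<lambda>x. \<bar>med k x\<bar>) =
      E (sketch_pmf k n B) (\<lambda>(h, s). \<bar>med k (G h s)\<bar>)"
    by (simp add: case_prod_unfold)
  also have "\<dots> = expected_error k n B i"
    unfolding expected_error_def
  proof (intro integral_cong_AE AE_pmfI)
    fix hs assume "hs \<in> set_pmf (sketch_pmf k n B)"
    then obtain h s where hs: "hs = (h, s)" and s: "s \<in> set_pmf (Pi_pmf {1..k} undefined (\<lambda>_. ?Q))"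
      by (auto simp: sketch_pmf_def)
    have si: "s l i = -1 \<or> s l i = 1" if "l \<in> {1..k}" for l
    proof -
      have "s l \<in> {1..n} \<rightarrow>\<^sub>E {-1, 1}" using s finQ that by (auto simp: set_Pi_pmf PiE_dflt_def)
      thus ?thesis using i by (auto simp: PiE_def Pi_def)
    qed
    have row: "s l i * (\<Sum>j\<in>{1..n}. of_bool (h l j = h l i) * s l j * zipf_freq j) = zipf_freq i + G h s l"
      if "l \<in> {1..k}" for l
    proof -
      have "(\<Sum>j\<in>{1..n}. of_bool (h l j = h l i) * s l j * zipf_freq j) =
          s l i * zipf_freq i + (\<Sum>j\<in>?J. of_bool (h l j = h l i) * s l j * zipf_freq j)"
        using i by (subst sum.remove[of _ i]) auto
      thus ?thesis using si[OF that] that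
        by (auto simp: G_def F_def zipf_freq_def sum_distrib_left algebra_simps sum_negf)
    qed
    have "count_sketch_estimate zipf_freq k n h s i = med k (\<lambda>l. zipf_freq i + G h s l)"
      unfolding count_sketch_estimate_def med_def
      by (intro arg_cong[of _ _ median] map_cong refl row) auto
    also have "\<dots> = zipf_freq i + med k (G h s)" by (rule med_add_const[OF k])
    finally show "(case hs of (h, s) \<Rightarrow> \<bar>med k (G h s)\<bar>) =
        (case hs of (h, s) \<Rightarrow> \<bar>count_sketch_estimate zipf_freq k n h s i - zipf_freq i\<bar>)"
      by (simp add: hs)
  qed auto
  finally show ?thesis ..
qed

section \<open>Symmetry, conditioning on one item, and the tail of the noise\<close>

lemma map_uminus_coll_pmf: "map_pmf uminus (coll_pmf q) = coll_pmf q"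
proof -
  have "map_pmf uminus (map_pmf (\<lambda>e. of_bool b * e) sign_pmf) = map_pmf (\<lambda>e. of_bool b * e) sign_pmf"
    for b
    using arg_cong[OF sign_pmf_mult[of "-1"], of "map_pmf (\<lambda>e. of_bool b * e)"]
    by (simp add: map_pmf_comp)
  thus ?thesis by (simp add: coll_pmf_def map_bind_pmf)
qed

lemma map_uminus_noise_pmf:
  assumes "finite J"
  shows "map_pmf uminus (noise_pmf q J) = noise_pmf q J"
proof -
  have "row_pmf q J = map_pmf (\<lambda>w. uminus \<circ> w) (row_pmf q J)"
    unfolding row_pmf_def using Pi_pmf_map[OF assms, of uminus "0::real" 0 "\<lambda>_. coll_pmf q"]
    by (simp add: map_uminus_coll_pmf)
  hence "noise_pmf q J = map_pmf (row_val J) (map_pmf (\<lambda>w. uminus \<circ> w) (row_pmf q J))"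
    by (simp add: noise_pmf_def)
  also have "\<dots> = map_pmf uminus (noise_pmf q J)"
    by (simp add: noise_pmf_def map_pmf_comp row_val_def sum_negf)
  finally show ?thesis ..
qed

text \<open>Conditioning on the three values of \<open>w j\<close>. The function \<open>F\<close>
  still sees this value, so that the noise can be studied jointly with the event of a collision at
  \<open>j\<close>.\<close>

lemma expectation_row_insert:
  fixes F :: "real \<Rightarrow> real \<Rightarrow> real"
  assumes "finite J" "j \<notin> J" "0 \<le> q" "q \<le> 1"
  shows "E (row_pmf q (insert j J)) (\<lambda>w. F (w j) (row_val (insert j J) w)) =
    (1 - q) * E (noise_pmf q J) (F 0) +
    q / 2 * (E (noise_pmf q J) (\<lambda>x. F 1 (1 / j + x)) + E (noise_pmf q J) (\<lambda>x. F (-1) (- 1 / j + x)))"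
proof -
  have "row_val (insert j J) (w(j := v)) = v / j + row_val J w" for w v
    using assms by (simp add: row_val_def) (intro sum.cong, auto)
  thus ?thesis
    using assms unfolding row_pmf_def
    by (subst expectation_Pi_insert) (auto simp: expectation_coll_pmf noise_pmf_def row_pmf_def)
qed

lemma expectation_noise_insert:
  fixes F :: "real \<Rightarrow> real"
  assumes "finite J" "j \<notin> J" "0 \<le> q" "q \<le> 1"
  shows "E (noise_pmf q (insert j J)) F = (1 - q) * E (noise_pmf q J) F +
    q / 2 * (E (noise_pmf q J) (\<lambda>x. F (1 / j + x)) + E (noise_pmf q J) (\<lambda>x. F (- 1 / j + x)))"
  using expectation_row_insert[OF assms, of "\<lambda>_. F"] by (simp add: noise_pmf_def)

text \<open>Telescoping from the first integer \<open>m\<close> above \<open>u\<close>, since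
  \<open>1 / x^2 \<le> 2 / x - 2 / (x + 1)\<close> for \<open>x \<ge> 1\<close>.\<close>

lemma sum_inverse_squares_le:
  assumes "finite C" "0 < u" "\<And>j. j \<in> C \<Longrightarrow> u < real j"
  shows "(\<Sum>j\<in>C. 1 / (real j)\<^sup>2) \<le> 2 / u"
proof -
  define m where "m = nat \<lfloor>u\<rfloor> + 1"
  have m: "u < real m" "1 \<le> m" unfolding m_def using assms(2) by (simp_all, linarith)
  have Cm: "m \<le> j" if "j \<in> C" for j
  proof -
    have "\<lfloor>u\<rfloor> < int j" using assms(3)[OF that] by (simp add: floor_less_iff)
    thus ?thesis unfolding m_def using assms(2) by (simp add: Suc_le_eq nat_less_iff)
  qed
  obtain M where M: "\<And>j. j \<in> C \<Longrightarrow> j < m + M"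
    using finite_nat_set_iff_bounded[of C] assms(1) by (metis trans_less_add2)
  have tele: "(\<Sum>j\<in>{m..<m + M}. 1 / (real j)\<^sup>2) \<le> 2 / m - 2 / (m + M)"
  proof (induction M)
    case (Suc M)
    have "1 / (real (m + M))\<^sup>2 \<le> 2 / (m + M) - 2 / (m + Suc M)"
    proof -
      define x where "x = real (m + M)"
      have x: "1 \<le> x" using m(2) by (simp add: x_def)
      have "2 / x - 2 / (x + 1) - 1 / x\<^sup>2 = (x - 1) / (x\<^sup>2 * (x + 1))"
        using x by (simp add: divide_simps power2_eq_square)
      also have "\<dots> \<ge> 0" using x by simp
      finally show ?thesis by (simp add: x_def add_ac)
    qed
    with Suc show ?case by simp
  qed simp
  have "(\<Sum>j\<in>C. 1 / (real j)\<^sup>2) \<le> (\<Sum>j\<in>{m..<m + M}. 1 / (real j)\<^sup>2)"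
    using Cm M by (intro sum_mono2) auto
  also have "\<dots> \<le> 2 / m" using tele by (simp add: order.trans)
  also have "\<dots> \<le> 2 / u" using m assms(2) by (intro divide_left_mono) auto
  finally show ?thesis .
qed

lemma card_nat_le:
  assumes "\<And>j. j \<in> A \<Longrightarrow> 1 \<le> j \<and> real j \<le> u" "0 \<le> u"
  shows "real (card A) \<le> u"
proof -
  have "A \<subseteq> {1..nat \<lfloor>u\<rfloor>}" using assms by (auto simp: le_nat_iff le_floor_iff)
  from card_mono[OF _ this] have "card A \<le> nat \<lfloor>u\<rfloor>" by simp
  thus ?thesis using assms(2) by linarith
qed

text \<open>Items are split at \<open>1 / t\<close>. By the union bound one of the at most
  \<open>1 / t\<close> near items collides with probability at most \<open>q / t\<close>. The far
  items have variance at most \<open>2 * q * t\<close>, and Chebyshev's inequality adds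
  \<open>2 * q / t\<close>.\<close>

lemma noise_tail:
  assumes J: "finite J" "0 \<notin> J" and q: "0 < q" "q \<le> 1" and t: "0 < t"
  shows "Pr (noise_pmf q J) {x. t < \<bar>x\<bar>} \<le> 3 * q / t"
proof -
  define A where "A = {j\<in>J. real j \<le> 1 / t}"
  define C where "C = {j\<in>J. 1 / t < real j}"
  let ?R = "row_pmf q J"
  define S where "S = (\<lambda>w :: nat \<Rightarrow> real. \<Sum>j\<in>J. of_bool (1 / t < real j) * w j / real j)"
  have fin: "finite (set_pmf ?R)" using J by simp
  have SA: "row_val J w = S w" if "\<not> (\<exists>j\<in>A. w j \<noteq> 0)" for w
    unfolding row_val_def S_def using that by (intro sum.cong) (auto simp: A_def not_less)
  have "E ?R (\<lambda>w. (S w)\<^sup>2) = (\<Sum>j\<in>J. E (coll_pmf q) (\<lambda>v. (of_bool (1 / t < real j) * v / real j)\<^sup>2))"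
    unfolding S_def row_pmf_def using J q
    by (intro expectation_sum_square_Pi[where g = "\<lambda>j v. of_bool (1 / t < real j) * v / real j"])
       (auto simp: expectation_coll_pmf)
  also have "\<dots> = (\<Sum>j\<in>J. q * (of_bool (1 / t < real j) * (1 / (real j)\<^sup>2)))"
    using q by (intro sum.cong) (auto simp: expectation_coll_pmf power_divide)
  also have "\<dots> = q * (\<Sum>j\<in>C. 1 / (real j)\<^sup>2)"
    unfolding sum_distrib_left[symmetric] C_def using J
    by (subst sum.inter_filter) (auto intro!: arg_cong[of _ _ "(*) q"] sum.cong)
  also have "\<dots> \<le> q * (2 / (1 / t))"
    using J q t by (intro mult_left_mono sum_inverse_squares_le) (auto simp: C_def)
  finally have S2: "E ?R (\<lambda>w. (S w)\<^sup>2) \<le> 2 * q * t" by simp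
  have "Pr (noise_pmf q J) {x. t < \<bar>x\<bar>} = Pr ?R {w. t < \<bar>row_val J w\<bar>}"
    by (simp add: noise_pmf_def vimage_def)
  also have "\<dots> \<le> Pr ?R {w. (\<exists>j\<in>A. w j \<noteq> 0) \<or> t \<le> \<bar>S w\<bar>}"
  proof (intro prob_mono_pmf)
    fix w assume "t < \<bar>row_val J w\<bar>"
    thus "(\<exists>j\<in>A. w j \<noteq> 0) \<or> t \<le> \<bar>S w\<bar>"
      using SA[of w] by (cases "\<exists>j\<in>A. w j \<noteq> 0") simp_all
  qed
  also have "\<dots> \<le> Pr ?R {w. \<exists>j\<in>A. w j \<noteq> 0} + Pr ?R {w. t \<le> \<bar>S w\<bar>}"
    by (rule prob_disj_le)
  also have "Pr ?R {w. t \<le> \<bar>S w\<bar>} \<le> 2 * q * t / t\<^sup>2"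
    by (rule Chebyshev_pmf[OF fin t S2])
  also have "Pr ?R {w. \<exists>j\<in>A. w j \<noteq> 0} \<le> (\<Sum>j\<in>A. Pr ?R {w. w j \<noteq> 0})"
    using J by (intro prob_Ex_le) (auto simp: A_def)
  also have "\<dots> = (\<Sum>j\<in>A. q)"
  proof (intro sum.cong refl)
    fix j assume "j \<in> A"
    hence "j \<in> J" by (simp add: A_def)
    thus "Pr ?R {w. w j \<noteq> 0} = q"
      using J q expectation_Pi_component[of J j 0 "\<lambda>_. coll_pmf q" "\<lambda>v. of_bool (v \<noteq> 0)"]
      by (simp add: prob_conv_expectation row_pmf_def expectation_coll_pmf)
  qed
  also have "\<dots> = card A * q" by simp
  also have "\<dots> \<le> 1 / t * q"
    using J q t by (intro mult_right_mono card_nat_le) (auto simp: A_def Suc_le_eq intro!: gr0I)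
  finally show ?thesis using t by (simp add: power2_eq_square field_simps)
qed

section \<open>Mass of the noise near zero, by symmetrization\<close>

lemma pmf_conv_expectation: "pmf p x = E p (\<lambda>y. of_bool (y = x))"
proof -
  have "{y. y = x} = {x}" by auto
  thus ?thesis using prob_conv_expectation[of p "\<lambda>y. y = x"] by (simp add: measure_pmf_single)
qed

text \<open>The difference takes the values 1 and -1 with probability \<open>b * (1 - b)\<close>
  each; the condition on \<open>b\<close> makes this \<open>q / 2\<close>. Equality of laws is
  checked on expectations of arbitrary \<open>F\<close>.\<close>

lemma coll_pmf_eq_difference:
  assumes b: "0 \<le> b" "b \<le> 1" "2 * b * (1 - b) = q"
  shows "coll_pmf q = bernoulli_pmf b \<bind> (\<lambda>u. map_pmf (\<lambda>v. of_bool u - of_bool v) (bernoulli_pmf b))"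
proof -
  have q: "0 \<le> q" using b by auto
  have "0 \<le> (1 - 2 * b)\<^sup>2" by simp
  hence q1: "q \<le> 1" using b(3) by (simp add: power2_eq_square algebra_simps)
  have eq: "bernoulli_pmf b \<bind> (\<lambda>u. map_pmf (\<lambda>v. of_bool u - of_bool v) (bernoulli_pmf b)) =
     map_pmf (\<lambda>(u, v). of_bool u - of_bool v :: real) (pair_pmf (bernoulli_pmf b) (bernoulli_pmf b))"
    by (simp add: pair_pmf_def map_pmf_def bind_assoc_pmf bind_return_pmf)
  have "E (map_pmf (\<lambda>(u, v). of_bool u - of_bool v) (pair_pmf (bernoulli_pmf b) (bernoulli_pmf b))) F
     = E (coll_pmf q) F" for F :: "real \<Rightarrow> real"
  proof -
    have "E (map_pmf (\<lambda>(u, v). of_bool u - of_bool v) (pair_pmf (bernoulli_pmf b) (bernoulli_pmf b))) F =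
        (b * F 0 + (1 - b) * F 1) * b + (b * F (- 1) + (1 - b) * F 0) * (1 - b)"
      using b by (simp add: case_prod_unfold expectation_pair_finite mult_ac)
    also have "\<dots> = (1 - 2 * b * (1 - b)) * F 0 + b * (1 - b) * (F 1 + F (-1))" by algebra
    also have "\<dots> = E (coll_pmf q) F"
      using expectation_coll_pmf[OF q q1, of F] by (simp flip: b(3))
    finally show ?thesis .
  qed
  thus ?thesis unfolding eq by (intro pmf_eqI) (simp only: pmf_conv_expectation)
qed

text \<open>The window is cut into \<open>N\<close> cells of length \<open>t\<close>. Two
  independent samples in the same cell are within \<open>t\<close>, and by Cauchy-Schwarz the
  squared cell probabilities sum to at least the squared window probability divided by
  \<open>N\<close>.\<close>

lemma prob_close_ge_pigeonhole:
  fixes Q :: "real pmf"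
  assumes fin: "finite (set_pmf Q)" and t: "0 < t" and N: "1 \<le> N"
  shows "(Pr Q {y. a \<le> y \<and> y < a + real N * t})\<^sup>2 / N \<le> Pr (pair_pmf Q Q) {z. \<bar>fst z - snd z\<bar> \<le> t}"
proof -
  \<comment> \<open>Half-open cells are disjoint, so each pair of samples is counted at most
    once.\<close>
  define I where "I = (\<lambda>m y. a + real m * t \<le> y \<and> y < a + real (Suc m) * t)"
  have cell: "I (nat \<lfloor>(y - a) / t\<rfloor>) y" if "a \<le> y" for y
  proof -
    have "real (nat \<lfloor>(y - a) / t\<rfloor>) = \<lfloor>(y - a) / t\<rfloor>" using that t by simp
    moreover have "\<lfloor>(y - a) / t\<rfloor> * t \<le> y - a" "y - a < (\<lfloor>(y - a) / t\<rfloor> + 1) * t"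
      using t by (simp_all flip: pos_le_divide_eq pos_divide_less_eq)
    ultimately show ?thesis by (simp add: I_def algebra_simps)
  qed
  have uniq: "m = m'" if "I m y" "I m' y" for m m' y
  proof -
    have "real m * t < real (Suc m') * t" "real m' * t < real (Suc m) * t" using that by (auto simp: I_def)
    hence "real m < real (Suc m')" "real m' < real (Suc m)" using t by (simp_all only: mult_less_cancel_right_pos)
    thus ?thesis by simp
  qed
  let ?W = "Pr Q {y. a \<le> y \<and> y < a + real N * t}"
  have "?W \<le> Pr Q {y. \<exists>m\<in>{..<N}. I m y}"
  proof (intro prob_mono_pmf)
    fix y assume y: "a \<le> y \<and> y < a + real N * t"
    let ?m = "nat \<lfloor>(y - a) / t\<rfloor>"
    have "real ?m * t < real N * t" using cell[of y] y by (simp add: I_def)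
    hence "?m < N" using t by (simp only: mult_less_cancel_right_pos of_nat_less_iff)
    thus "\<exists>m\<in>{..<N}. I m y" using cell[of y] y by blast
  qed
  also have "\<dots> \<le> (\<Sum>m<N. Pr Q {y. I m y})" by (rule prob_Ex_le) simp
  finally have "?W\<^sup>2 \<le> (\<Sum>m<N. Pr Q {y. I m y})\<^sup>2" by (intro power_mono) auto
  also have "\<dots> \<le> (\<Sum>m<N. (Pr Q {y. I m y})\<^sup>2) * real (card {..<N})"
    by (rule sum_squared_le_sum_of_squares)
  finally have 1: "?W\<^sup>2 / N \<le> (\<Sum>m<N. (Pr Q {y. I m y})\<^sup>2)"
    using N by (simp add: divide_le_eq)
  have "(\<Sum>m<N. (Pr Q {y. I m y})\<^sup>2) = (\<Sum>m<N. Pr (pair_pmf Q Q) {z. I m (fst z) \<and> I m (snd z)})"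
    by (simp add: prob_pair_Times fin power2_eq_square)
  also have "\<dots> = E (pair_pmf Q Q) (\<lambda>z. \<Sum>m<N. of_bool (I m (fst z) \<and> I m (snd z)))"
    unfolding prob_conv_expectation using fin by (intro expectation_finite_sum[symmetric]) simp
  also have "\<dots> \<le> Pr (pair_pmf Q Q) {z. \<bar>fst z - snd z\<bar> \<le> t}"
    unfolding prob_conv_expectation
  proof (intro expectation_mono_finite)
    fix z
    show "(\<Sum>m<N. of_bool (I m (fst z) \<and> I m (snd z))) \<le> (of_bool (\<bar>fst z - snd z\<bar> \<le> t) :: real)"
    proof (cases "\<exists>m<N. I m (fst z) \<and> I m (snd z)")
      case True
      then obtain m where m: "m < N" "I m (fst z)" "I m (snd z)" by blast
      have "(\<Sum>m'<N. of_bool (I m' (fst z) \<and> I m' (snd z))) = (\<Sum>m'<N. of_bool (m' = m) :: real)"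
        using m uniq by (intro sum.cong) auto
      also have "\<dots> \<le> 1" by (simp add: of_bool_def)
      finally show ?thesis using m(2,3) t by (auto simp: I_def algebra_simps abs_le_iff)
    next
      case False
      hence "(\<Sum>m<N. of_bool (I m (fst z) \<and> I m (snd z))) = (0::real)" by (intro sum.neutral) auto
      thus ?thesis by simp
    qed
  qed (use fin in auto)
  finally show ?thesis using 1 by simp
qed

text \<open>Writing every collision variable as a difference of Bernoulli variables and summing
  gives \<open>X = Y - Y'\<close> with independent \<open>Y\<close>, \<open>Y'\<close> of law
  \<open>Q\<close>. Closeness of two samples of \<open>Q\<close> then becomes smallness of the
  noise.\<close>

lemma noise_pmf_eq_difference:
  assumes J: "finite J" and b: "0 \<le> b" "b \<le> 1" "2 * b * (1 - b) = q"
  defines "Q \<equiv> map_pmf (\<lambda>e. \<Sum>j\<in>J. of_bool (e j) / real j) (Pi_pmf J False (\<lambda>_. bernoulli_pmf b))"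
  shows "noise_pmf q J = map_pmf (\<lambda>z. fst z - snd z) (pair_pmf Q Q)"
proof -
  let ?P = "Pi_pmf J False (\<lambda>_. bernoulli_pmf b)"
  have "row_pmf q J = ?P \<bind> (\<lambda>h. map_pmf (\<lambda>s l. if l \<in> J then of_bool (h l) - of_bool (s l) else 0) ?P)"
    unfolding Pi_pmf_product_of_pairs[OF J, where F = "\<lambda>_ u v. of_bool u - of_bool v"] row_pmf_def
    by (simp only: coll_pmf_eq_difference[OF b])
  hence "noise_pmf q J = ?P \<bind> (\<lambda>h. map_pmf (\<lambda>s. (\<Sum>j\<in>J. of_bool (h j) / j) - (\<Sum>j\<in>J. of_bool (s j) / j)) ?P)"
    by (simp add: noise_pmf_def map_bind_pmf map_pmf_comp row_val_def diff_divide_distrib sum_subtractf)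
  thus ?thesis
    by (simp add: Q_def pair_pmf_def map_pmf_def bind_assoc_pmf bind_return_pmf)
qed

text \<open>With probability at least 1/8, \<open>Y\<close> lies in a window of length
  \<open>6 * q\<close> around \<open>\<mu>\<close>, the mean of its part with
  \<open>j > 1 / q\<close>: no item \<open>j \<le> 1 / q\<close> is drawn except with probability
  3/4, and the far part deviates by \<open>3 * q\<close> with probability at most 1/9. The
  pigeonhole bound then applies.\<close>

lemma noise_small_ball:
  assumes J: "finite J" "0 \<notin> J" and q: "0 < q" "q \<le> 1 / 3" and t: "0 < t" "t \<le> q"
  shows "t / (448 * q) \<le> Pr (noise_pmf q J) {x. \<bar>x\<bar> \<le> t}"
proof -
  \<comment> \<open>The smaller root of \<open>2 * b * (1 - b) = q\<close>.\<close>
  define b where "b = (1 - sqrt (1 - 2 * q)) / 2"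
  have r: "0 \<le> sqrt (1 - 2 * q)" "sqrt (1 - 2 * q) \<le> 1" "(sqrt (1 - 2 * q))\<^sup>2 = 1 - 2 * q"
    using q by auto
  have b: "0 \<le> b" "b \<le> 1 / 2" "2 * b * (1 - b) = q"
    using r by (simp_all add: b_def field_simps power2_eq_square)
  \<comment> \<open>Two rounds: \<open>b \<le> 1 / 2\<close> gives
    \<open>b \<le> q \<le> 1 / 3\<close>, and then \<open>1 - b \<ge> 2 / 3\<close> gives
    \<open>b \<le> 3 / 4 * q\<close>. The factor 3/4 keeps the union bound over up to
    \<open>1 / q\<close> near items below 1.\<close>
  have "0 \<le> b * (1 / 2 - b)" using b by simp
  hence "b \<le> q" unfolding b(3)[symmetric] by (simp add: algebra_simps)
  hence "0 \<le> b * (1 / 3 - b)" using b q by simp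
  hence b34: "b \<le> 3 / 4 * q" unfolding b(3)[symmetric] by (simp add: algebra_simps)
  let ?P = "Pi_pmf J False (\<lambda>_. bernoulli_pmf b)"
  define Y where "Y = (\<lambda>e. \<Sum>j\<in>J. of_bool (e j) / real j)"
  define Q where "Q = map_pmf Y ?P"
  have finP: "finite (set_pmf ?P)" using J by (simp add: finite_set_Pi_pmf)
  define A where "A = {j\<in>J. real j \<le> 1 / q}"
  define C where "C = {j\<in>J. 1 / q < real j}"
  define S where "S = (\<lambda>e. \<Sum>j\<in>J. of_bool (1 / q < real j) * (of_bool (e j) - b) / real j)"
  define \<mu> where "\<mu> = (\<Sum>j\<in>J. of_bool (1 / q < real j) * b / real j)"
  have YS: "Y e = S e + \<mu>" if "\<not> (\<exists>j\<in>A. e j)" for e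
    unfolding Y_def S_def \<mu>_def sum.distrib[symmetric] using that
    by (intro sum.cong refl) (auto simp: A_def not_less diff_divide_distrib)
  have "E ?P (\<lambda>e. (S e)\<^sup>2) = (\<Sum>j\<in>J. E (bernoulli_pmf b) (\<lambda>e. (of_bool (1 / q < real j) * (of_bool e - b) / real j)\<^sup>2))"
    unfolding S_def using J b
    by (intro expectation_sum_square_Pi[where g = "\<lambda>j e. of_bool (1 / q < real j) * (of_bool e - b) / real j"])
       (auto simp: algebra_simps)
  also have "\<dots> = (\<Sum>j\<in>J. q / 2 * (of_bool (1 / q < real j) * (1 / (real j)\<^sup>2)))"
  proof (intro sum.cong refl)
    fix j
    have "E (bernoulli_pmf b) (\<lambda>e. (of_bool (1 / q < real j) * (of_bool e - b) / real j)\<^sup>2) =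
        (b * (1 - b)\<^sup>2 + (1 - b) * b\<^sup>2) * (of_bool (1 / q < real j) * (1 / (real j)\<^sup>2))"
      using b by (simp add: power_divide of_bool_def add_divide_distrib mult.commute)
    also have "b * (1 - b)\<^sup>2 + (1 - b) * b\<^sup>2 = q / 2"
      unfolding b(3)[symmetric] by (simp add: power2_eq_square algebra_simps)
    finally show "E (bernoulli_pmf b) (\<lambda>e. (of_bool (1 / q < real j) * (of_bool e - b) / real j)\<^sup>2) =
        q / 2 * (of_bool (1 / q < real j) * (1 / (real j)\<^sup>2))" .
  qed
  also have "\<dots> = q / 2 * (\<Sum>j\<in>C. 1 / (real j)\<^sup>2)"
    unfolding sum_distrib_left[symmetric] C_def using J
    by (subst sum.inter_filter) (auto intro!: arg_cong[of _ _ "(*) q"] sum.cong)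
  also have "\<dots> \<le> q / 2 * (2 / (1 / q))"
    using J q by (intro mult_left_mono sum_inverse_squares_le) (auto simp: C_def)
  finally have S2: "E ?P (\<lambda>e. (S e)\<^sup>2) \<le> q\<^sup>2" by (simp add: power2_eq_square)
  define N where "N = nat \<lceil>6 * q / t\<rceil>"
  have N: "6 * q / t \<le> N" "real N \<le> 6 * q / t + 1" "1 \<le> N"
  proof -
    have p: "0 < 6 * q / t" using q t by simp
    hence "0 < \<lceil>6 * q / t\<rceil>" by simp
    thus "1 \<le> N" unfolding N_def by linarith
    have "real N = \<lceil>6 * q / t\<rceil>" using p by (simp add: N_def)
    thus "6 * q / t \<le> N" "real N \<le> 6 * q / t + 1" by linarith+
  qed
  have Nt: "6 * q \<le> N * t" using N(1) t by (simp add: pos_divide_le_eq)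
  have "1 / 8 \<le> 1 - (3 / 4 + q\<^sup>2 / (3 * q)\<^sup>2)" using q by (simp add: power2_eq_square)
  also have "\<dots> \<le> 1 - (Pr ?P {e. \<exists>j\<in>A. e j} + Pr ?P {e. 3 * q \<le> \<bar>S e\<bar>})"
  proof (intro diff_left_mono add_mono)
    show "Pr ?P {e. 3 * q \<le> \<bar>S e\<bar>} \<le> q\<^sup>2 / (3 * q)\<^sup>2"
      using q by (intro Chebyshev_pmf finP S2) auto
    have "Pr ?P {e. \<exists>j\<in>A. e j} \<le> (\<Sum>j\<in>A. Pr ?P {e. e j})"
      using J by (intro prob_Ex_le) (auto simp: A_def)
    also have "\<dots> = (\<Sum>j\<in>A. b)"
    proof (intro sum.cong refl)
      fix j assume "j \<in> A"
      hence "j \<in> J" by (simp add: A_def)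
      thus "Pr ?P {e. e j} = b"
        using J b expectation_Pi_component[of J j False "\<lambda>_. bernoulli_pmf b" of_bool]
        by (simp add: prob_conv_expectation)
    qed
    also have "\<dots> = card A * b" by simp
    also have "\<dots> \<le> 1 / q * (3 / 4 * q)"
      using J q b b34 by (intro mult_mono card_nat_le) (auto simp: A_def Suc_le_eq intro!: gr0I)
    finally show "Pr ?P {e. \<exists>j\<in>A. e j} \<le> 3 / 4" using q by simp
  qed
  also have "\<dots> \<le> 1 - Pr ?P {e. (\<exists>j\<in>A. e j) \<or> 3 * q \<le> \<bar>S e\<bar>}"
    by (intro diff_left_mono prob_disj_le)
  also have "\<dots> = Pr ?P {e. \<not> ((\<exists>j\<in>A. e j) \<or> 3 * q \<le> \<bar>S e\<bar>)}"
    by (subst measure_pmf.prob_compl[symmetric]) (auto intro!: arg_cong[of _ _ "Pr ?P"])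
  also have "\<dots> \<le> Pr ?P {e. \<mu> - 3 * q \<le> Y e \<and> Y e < \<mu> - 3 * q + N * t}"
    using Nt YS by (intro prob_mono_pmf) (auto simp: abs_less_iff not_le)
  also have "\<dots> = Pr Q {y. \<mu> - 3 * q \<le> y \<and> y < \<mu> - 3 * q + N * t}"
    by (simp add: Q_def vimage_def)
  finally have W: "1 / 8 \<le> Pr Q {y. \<mu> - 3 * q \<le> y \<and> y < \<mu> - 3 * q + N * t}" .
  \<comment> \<open>Since \<open>t \<le> q\<close>, rounding up costs at most one further
    \<open>q / t\<close>; then 448 is 7 times 8 squared.\<close>
  have "real N \<le> 7 * q / t"
  proof -
    have "1 \<le> q / t" using q t by simp
    thus ?thesis using N(2) by simp
  qed
  hence "t / (448 * q) \<le> (1 / 8)\<^sup>2 / N"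
    using N(3) q t by (simp add: field_simps power2_eq_square)
  also have "\<dots> \<le> (Pr Q {y. \<mu> - 3 * q \<le> y \<and> y < \<mu> - 3 * q + N * t})\<^sup>2 / N"
    using W by (intro divide_right_mono power_mono) auto
  also have "\<dots> \<le> Pr (pair_pmf Q Q) {z. \<bar>fst z - snd z\<bar> \<le> t}"
    using t N finP by (intro prob_close_ge_pigeonhole) (auto simp: Q_def)
  also have "\<dots> = Pr (noise_pmf q J) {x. \<bar>x\<bar> \<le> t}"
    using noise_pmf_eq_difference[of J b q] J b by (simp add: Q_def Y_def vimage_def)
  finally show ?thesis .
qed

section \<open>Anti-concentration of the noise\<close>

lemma noise_far:
  assumes "finite A" "finite C" "A \<inter> C = {}" "\<And>j. j \<in> A \<Longrightarrow> s \<le> 1 / real j" "0 \<le> q" "q \<le> 1"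
  shows "(1 - (1 - q) ^ card A) / 2 \<le> Pr (noise_pmf q (A \<union> C)) {x. s \<le> \<bar>x\<bar>}"
  using assms
proof (induction rule: finite_induct)
  case (insert j A)
  let ?D = "noise_pmf q (A \<union> C)" and ?F = "\<lambda>x. of_bool (s \<le> \<bar>x\<bar>) :: real"
  have fin: "finite (set_pmf ?D)" using insert by simp
  have sj: "s \<le> 1 / j" using insert.prems by simp
  \<comment> \<open>If \<open>j\<close> collides, then for any value \<open>x\<close> of the rest
    one of the two signs takes the noise to distance at least \<open>1 / j \<ge> s\<close> from 0.
    Hence at least half of the collision probability counts.\<close>
  have "1 = E ?D (\<lambda>_. 1 :: real)" by simp
  also have "\<dots> \<le> E ?D (\<lambda>x. ?F (1 / j + x) + ?F (- 1 / j + x))"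
    using fin
  proof (rule expectation_mono_finite)
    fix x
    show "1 \<le> ?F (1 / j + x) + ?F (- 1 / j + x)"
      using sj by (cases "0 \<le> x") (auto simp: abs_if)
  qed
  finally have 1: "1 \<le> E ?D (\<lambda>x. ?F (1 / j + x)) + E ?D (\<lambda>x. ?F (- 1 / j + x))"
    by (simp add: expectation_finite_linear fin)
  have IH: "(1 - (1 - q) ^ card A) / 2 \<le> E ?D ?F"
    using insert by (simp add: prob_conv_expectation)
  have "(1 - (1 - q) ^ card (insert j A)) / 2 = (1 - q) * ((1 - (1 - q) ^ card A) / 2) + q / 2 * 1"
    using insert by (simp add: field_simps)
  also have "\<dots> \<le> (1 - q) * E ?D ?F + q / 2 * (E ?D (\<lambda>x. ?F (1 / j + x)) + E ?D (\<lambda>x. ?F (- 1 / j + x)))"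
    using IH 1 insert.prems by (intro add_mono mult_left_mono) auto
  also have "\<dots> = Pr (noise_pmf q (insert j A \<union> C)) {x. s \<le> \<bar>x\<bar>}"
    using insert expectation_noise_insert[of "A \<union> C" j q ?F] by (simp add: prob_conv_expectation)
  finally show ?case .
qed simp

text \<open>Reciprocals of consecutive integers in \<open>(N, 2 N]\<close> differ by at least
  \<open>1 / (4 N^2)\<close>, and the interval of admissible values has length
  \<open>2 * t\<close>.\<close>

lemma card_reciprocals_le:
  assumes N: "1 \<le> N" and blk: "\<And>j. j \<in> K \<Longrightarrow> N < j \<and> j \<le> 2 * N" and t: "0 \<le> t"
  shows "real (card {j\<in>K. \<bar>x + 1 / real j\<bar> \<le> t}) \<le> 1 + 8 * (real N)\<^sup>2 * t"
proof (cases "{j\<in>K. \<bar>x + 1 / real j\<bar> \<le> t} = {}")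
  case False
  let ?S = "{j\<in>K. \<bar>x + 1 / real j\<bar> \<le> t}"
  have "?S \<subseteq> {..2 * N}" using blk by auto
  hence fin: "finite ?S" by (rule finite_subset) simp
  define a where "a = Min ?S"
  define b where "b = Max ?S"
  have abS: "a \<in> ?S" "b \<in> ?S"
    unfolding a_def b_def by (rule Min_in[OF fin False], rule Max_in[OF fin False])
  have "a \<le> b" unfolding a_def by (rule Min_le[OF fin abS(2)])
  note ab = abS this
  have pos: "0 < real a" "0 < real b" using blk[of a] blk[of b] ab N by auto
  have "1 / real a - 1 / real b \<le> 2 * t" using ab by auto
  hence "real b - real a \<le> 2 * t * (real a * real b)"
    using pos by (simp add: field_simps)
  also have "\<dots> \<le> 2 * t * ((2 * real N) * (2 * real N))"
    using blk[of a] blk[of b] ab t by (intro mult_left_mono mult_mono) auto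
  finally have "real b - real a \<le> 8 * (real N)\<^sup>2 * t" by (simp add: power2_eq_square algebra_simps)
  moreover have "card ?S \<le> card {a..b}"
    using fin by (intro card_mono) (auto simp: a_def b_def)
  hence "real (card ?S) \<le> 1 + (real b - real a)" using ab(3) by simp
  ultimately show ?thesis by simp
next
  case True
  show ?thesis unfolding True using t by simp
qed

text \<open>Given a collision at \<open>j\<close>, the noise is a shift by \<open>1 / j\<close> or
  \<open>- 1 / j\<close> of the noise on \<open>J - {j}\<close>. As \<open>j\<close> fails to
  collide with probability at least 1/2, that law is at most twice the full noise law, which removes
  the dependence on \<open>j\<close>.\<close>

lemma expectation_collision_small:
  assumes J: "finite J" "j \<in> J" and q: "0 \<le> q" "q \<le> 1 / 2"
  shows "E (row_pmf q J) (\<lambda>w. of_bool (w j \<noteq> 0 \<and> \<bar>row_val J w\<bar> \<le> t))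
    \<le> q * (Pr (noise_pmf q J) {x. \<bar>x + 1 / j\<bar> \<le> t} + Pr (noise_pmf q J) {x. \<bar>- x + 1 / j\<bar> \<le> t})"
proof -
  define I where "I = J - {j}"
  have I: "finite I" "j \<notin> I" "J = insert j I" using J by (auto simp: I_def)
  let ?D = "noise_pmf q I"
  have le: "Pr ?D {x. P x} \<le> 2 * Pr (noise_pmf q J) {x. P x}" for P
  proof -
    have "1 / 2 * Pr ?D {x. P x} \<le> (1 - q) * E ?D (\<lambda>x. of_bool (P x))"
      unfolding prob_conv_expectation using q by (intro mult_right_mono) auto
    also have "\<dots> \<le> Pr (noise_pmf q J) {x. P x}"
      unfolding prob_conv_expectation I(3)
      using q I by (subst expectation_noise_insert) (auto intro!: mult_nonneg_nonneg add_nonneg_nonneg)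
    finally show ?thesis by simp
  qed
  have "E (row_pmf q J) (\<lambda>w. of_bool (w j \<noteq> 0 \<and> \<bar>row_val J w\<bar> \<le> t)) =
      q / 2 * (Pr ?D {x. \<bar>1 / j + x\<bar> \<le> t} + Pr ?D {x. \<bar>- 1 / j + x\<bar> \<le> t})"
    unfolding prob_conv_expectation I(3)
    using q I expectation_row_insert[of I j q "\<lambda>v x. of_bool (v \<noteq> 0 \<and> \<bar>x\<bar> \<le> t)"] by simp
  also have "\<dots> \<le> q / 2 * (2 * Pr (noise_pmf q J) {x. \<bar>1 / j + x\<bar> \<le> t}
      + 2 * Pr (noise_pmf q J) {x. \<bar>- 1 / j + x\<bar> \<le> t})"
    using q by (intro mult_left_mono add_mono le) auto
  also have "\<dots> = q * (Pr (noise_pmf q J) {x. \<bar>x + 1 / j\<bar> \<le> t} + Pr (noise_pmf q J) {x. \<bar>- x + 1 / j\<bar> \<le> t})"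
  proof -
    have "\<bar>1 / j + x\<bar> = \<bar>x + 1 / j\<bar>" "\<bar>- 1 / j + x\<bar> = \<bar>- x + 1 / j\<bar>" for x :: real
      by (simp_all add: abs_if)
    thus ?thesis by (simp add: algebra_simps)
  qed
  finally show ?thesis .
qed

text \<open>
  Let \<open>M\<close> count the collisions in \<open>K\<close>. The case \<open>M \<le> m\<close> is handled by the moment generating function
  of \<open>M\<close>, and the case \<open>M > m\<close> by \<open>E[M; \<bar>X\<bar> \<le> t]\<close>: deleting a collision at \<open>j\<close> shifts \<open>X\<close> by
  \<open>1 / j\<close> up to sign, and few \<open>j\<close> shift a given value into \<open>[-t, t]\<close>.
\<close>
lemma noise_concentration_le:
  fixes N m :: nat
  assumes J: "finite J" and K: "K \<subseteq> J" "\<And>j. j \<in> K \<Longrightarrow> N < j \<and> j \<le> 2 * N" and N: "1 \<le> N"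
    and q: "0 \<le> q" "q \<le> 1 / 2" and t: "0 \<le> t" and m: "1 \<le> m"
  shows "Pr (noise_pmf q J) {x. \<bar>x\<bar> \<le> t} \<le>
    2 ^ m * exp (- q * card K / 2) + 2 * q * (1 + 8 * (real N)\<^sup>2 * t) / m"
proof -
  let ?R = "row_pmf q J" and ?D = "noise_pmf q J"
  have fin: "finite (set_pmf ?R)" "finite (set_pmf ?D)" "finite K"
    using J K(1) by (auto intro: finite_subset)
  define M where "M = (\<lambda>w :: nat \<Rightarrow> real. card {j\<in>K. w j \<noteq> 0})"
  define H where "H = (\<lambda>w. of_bool (\<bar>row_val J w\<bar> \<le> t) :: real)"
  have M: "real (M w) = (\<Sum>j\<in>K. of_bool (w j \<noteq> 0))" for w
    using fin by (simp add: M_def of_bool_def sum.If_cases Int_def)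
  have "E ?R (\<lambda>w. real (M w) * H w) =
      (\<Sum>j\<in>K. E ?R (\<lambda>w. of_bool (w j \<noteq> 0 \<and> \<bar>row_val J w\<bar> \<le> t)))"
    unfolding M H_def sum_distrib_right of_bool_conj[symmetric]
    by (intro expectation_finite_sum fin)
  also have "\<dots> \<le> (\<Sum>j\<in>K. q * (Pr ?D {x. \<bar>x + 1 / j\<bar> \<le> t} + Pr ?D {x. \<bar>- x + 1 / j\<bar> \<le> t}))"
    using J K q by (intro sum_mono expectation_collision_small) auto
  also have "\<dots> = q * E ?D (\<lambda>x. (\<Sum>j\<in>K. of_bool (\<bar>x + 1 / j\<bar> \<le> t)) + (\<Sum>j\<in>K. of_bool (\<bar>- x + 1 / j\<bar> \<le> t)))"
    unfolding expectation_finite_linear[OF fin(2)] expectation_finite_sum[OF fin(2)] prob_conv_expectation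
    by (simp only: sum_distrib_left[symmetric] sum.distrib[symmetric])
  also have "\<dots> \<le> q * E ?D (\<lambda>x. 2 * (1 + 8 * (real N)\<^sup>2 * t))"
  proof (intro mult_left_mono expectation_mono_finite fin q)
    fix x :: real
    have "(\<Sum>j\<in>K. of_bool (\<bar>y + 1 / j\<bar> \<le> t)) \<le> 1 + 8 * (real N)\<^sup>2 * t" for y :: real
    proof -
      have "(\<Sum>j\<in>K. of_bool (\<bar>y + 1 / j\<bar> \<le> t)) = real (card {j\<in>K. \<bar>y + 1 / real j\<bar> \<le> t})"
        using fin by (simp add: of_bool_def sum.If_cases Int_def)
      thus ?thesis using card_reciprocals_le[OF N _ t, of K y] K(2) by simp
    qed
    from this[of x] this[of "- x"]
    show "(\<Sum>j\<in>K. of_bool (\<bar>x + 1 / j\<bar> \<le> t)) + (\<Sum>j\<in>K. of_bool (\<bar>- x + 1 / j\<bar> \<le> t))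
        \<le> 2 * (1 + 8 * (real N)\<^sup>2 * t)" unfolding mult_2 by (rule add_mono)
  qed
  finally have MH: "E ?R (\<lambda>w. real (M w) * H w) \<le> 2 * q * (1 + 8 * (real N)\<^sup>2 * t)"
    by (simp add: algebra_simps)
  have "E ?R (\<lambda>w. (1 / 2 :: real) ^ M w) = E ?R (\<lambda>w. \<Prod>j\<in>J. if j \<in> K \<and> w j \<noteq> 0 then 1 / 2 else 1)"
  proof -
    have "(\<Prod>j\<in>J. if j \<in> K \<and> w j \<noteq> 0 then 1 / 2 else 1) = (1 / 2 :: real) ^ M w" for w
    proof -
      have "{j \<in> J. j \<in> K \<and> w j \<noteq> 0} = {j \<in> K. w j \<noteq> 0}" using K(1) by auto
      thus ?thesis using J by (simp add: prod.If_cases Int_def M_def)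
    qed
    thus ?thesis by simp
  qed
  also have "\<dots> = (\<Prod>j\<in>J. E (coll_pmf q) (\<lambda>v. if j \<in> K \<and> v \<noteq> 0 then 1 / 2 else 1))"
    unfolding row_pmf_def using J
    by (intro expectation_prod_Pi_pmf[where f = "\<lambda>j v. if j \<in> K \<and> v \<noteq> 0 then 1 / 2 else 1"])
       (auto intro!: integrable_measure_pmf_finite)
  also have "\<dots> = (\<Prod>j\<in>J. if j \<in> K then 1 - q / 2 else 1)"
    using q by (intro prod.cong refl) (auto simp: expectation_coll_pmf field_simps)
  also have "\<dots> = (1 - q / 2) ^ card K"
    using J K(1) by (simp add: prod.If_cases Int_absorb1)
  also have "\<dots> \<le> exp (- (q / 2)) ^ card K"
    using q exp_ge_add_one_self[of "- (q / 2)"] by (intro power_mono) auto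
  also have "\<dots> = exp (- q * card K / 2)" by (simp flip: exp_of_nat_mult add: mult_ac)
  finally have Mexp: "E ?R (\<lambda>w. (1 / 2) ^ M w) \<le> exp (- q * card K / 2)" .
  have "Pr ?D {x. \<bar>x\<bar> \<le> t} = E ?R H"
    by (simp add: noise_pmf_def H_def vimage_def prob_conv_expectation)
  \<comment> \<open>Pointwise: if \<open>M w \<le> m\<close> the first summand is at least 1, and
    otherwise \<open>M w / m\<close> exceeds 1.\<close>
  also have "\<dots> \<le> E ?R (\<lambda>w. 2 ^ m * (1 / 2) ^ M w + real (M w) * H w / m)"
  proof (intro expectation_mono_finite fin)
    fix w
    show "H w \<le> 2 ^ m * (1 / 2) ^ M w + real (M w) * H w / m"
    proof (cases "M w \<le> m")
      case True
      hence "(2::real) ^ M w \<le> 2 ^ m" by (intro power_increasing) auto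
      hence "1 \<le> 2 ^ m * (1 / 2 :: real) ^ M w" by (simp add: power_divide)
      moreover have "H w \<le> 1" "0 \<le> real (M w) * H w / m" by (simp_all add: H_def)
      ultimately show ?thesis by linarith
    next
      case False
      hence "1 * H w \<le> real (M w) / m * H w" using m by (intro mult_right_mono) (auto simp: H_def)
      thus ?thesis by (simp add: add_increasing)
    qed
  qed
  also have "\<dots> = 2 ^ m * E ?R (\<lambda>w. (1 / 2) ^ M w) + E ?R (\<lambda>w. real (M w) * H w) / m"
    by (simp add: expectation_finite_linear fin)
  also have "\<dots> \<le> 2 ^ m * exp (- q * card K / 2) + 2 * q * (1 + 8 * (real N)\<^sup>2 * t) / m"
    using Mexp MH m by (intro add_mono mult_left_mono divide_right_mono) auto
  finally show ?thesis .
qed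

section \<open>The median of independent rows\<close>

lemma expectation_rows_count:
  assumes "finite (set_pmf D)"
  shows "E (Pi_pmf {1..k} d (\<lambda>_. D)) (rows_count k P) = k * Pr D {x. P x}"
proof -
  have "E (Pi_pmf {1..k} d (\<lambda>_. D)) (rows_count k P) =
      (\<Sum>l\<in>{1..k}. E (Pi_pmf {1..k} d (\<lambda>_. D)) (\<lambda>x. of_bool (P (x l))))"
    unfolding rows_count_def using assms by (intro expectation_finite_sum finite_set_Pi_pmf) auto
  thus ?thesis
    using expectation_Pi_component[of "{1..k}" _ d "\<lambda>_. D" "\<lambda>v. of_bool (P v)"]
    by (simp add: prob_conv_expectation)
qed

text \<open>The count has variance at most \<open>k\<close>, and a majority exceeds its mean by at
  least \<open>k * e\<close>.\<close>

lemma prob_majority_Chebyshev: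
  assumes fin: "finite (set_pmf D)" and k: "1 \<le> k" and e: "0 < e"
    and p: "Pr D {x. P x} \<le> 1 / 2 - e"
  shows "Pr (Pi_pmf {1..k} d (\<lambda>_. D)) {x. k < 2 * rows_count k P x} \<le> 1 / (k * e\<^sup>2)"
proof -
  let ?R = "Pi_pmf {1..k} d (\<lambda>_. D)" and ?p = "Pr D {x. P x}"
  have finR: "finite (set_pmf ?R)" using fin by (simp add: finite_set_Pi_pmf)
  let ?g = "\<lambda>y. of_bool (P y) - ?p"
  have g0: "E D ?g = 0" using fin by (simp add: expectation_finite_linear prob_conv_expectation)
  have g2: "E D (\<lambda>y. (?g y)\<^sup>2) \<le> 1"
  proof -
    have "\<bar>?g y\<bar> \<le> 1" for y by auto
    hence "E D (\<lambda>y. (?g y)\<^sup>2) \<le> E D (\<lambda>_. 1)"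
      using fin by (intro expectation_mono_finite) (simp_all only: abs_square_le_1)
    thus ?thesis by simp
  qed
  have "E ?R (\<lambda>x. (rows_count k P x - k * ?p)\<^sup>2) = E ?R (\<lambda>x. (\<Sum>l\<in>{1..k}. ?g (x l))\<^sup>2)"
    by (simp add: rows_count_def sum_subtractf)
  also have "\<dots> = (\<Sum>l\<in>{1..k}. E D (\<lambda>y. (?g y)\<^sup>2))"
    using fin g0 by (intro expectation_sum_square_Pi[where g = "\<lambda>_. ?g"]) auto
  also have "\<dots> \<le> (\<Sum>l\<in>{1..k}. 1)" using g2 by (intro sum_mono) auto
  finally have v: "E ?R (\<lambda>x. (rows_count k P x - k * ?p)\<^sup>2) \<le> k" by simp
  have "Pr ?R {x. k < 2 * rows_count k P x} \<le> Pr ?R {x. k * e \<le> \<bar>rows_count k P x - k * ?p\<bar>}"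
  proof (intro prob_mono_pmf)
    fix x assume "real k < 2 * rows_count k P x"
    moreover have "real k * ?p \<le> k * (1 / 2 - e)" using p by (intro mult_left_mono) auto
    ultimately show "k * e \<le> \<bar>rows_count k P x - k * ?p\<bar>" by (simp add: algebra_simps)
  qed
  also have "\<dots> \<le> k / (k * e)\<^sup>2"
    using k e by (intro Chebyshev_pmf finR v) auto
  also have "\<dots> = 1 / (k * e\<^sup>2)" using k by (simp add: power2_eq_square)
  finally show ?thesis .
qed

text \<open>Markov's inequality for the product with a factor \<open>1 / q\<close> for each row
  satisfying \<open>P\<close>. Each row contributes expectation at most 2, and a majority means at
  least \<open>m\<close> such factors.\<close>

lemma prob_majority_exponential:
  assumes fin: "finite (set_pmf D)" and k: "k + 1 = 2 * m" and q: "0 < q" "q \<le> 1"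
    and p: "Pr D {x. P x} \<le> q"
  shows "Pr (Pi_pmf {1..k} d (\<lambda>_. D)) {x. k < 2 * rows_count k P x} \<le> (4 * q) ^ m"
proof -
  let ?R = "Pi_pmf {1..k} d (\<lambda>_. D)" and ?p = "Pr D {x. P x}"
  have finR: "finite (set_pmf ?R)" using fin by (simp add: finite_set_Pi_pmf)
  let ?f = "\<lambda>y. if P y then 1 / q else 1"
  have prod_eq: "(\<Prod>l\<in>A. ?f (x l)) = (1 / q) ^ card {l\<in>A. P (x l)}" if "finite A" for x and A :: "nat set"
    using that by (simp add: prod.If_cases Int_def)
  have cnt: "rows_count k P x = card {l\<in>{1..k}. P (x l)}" for x
    by (simp add: rows_count_def of_bool_def sum.If_cases Int_def)
  have "Pr ?R {x. k < 2 * rows_count k P x} \<le> E ?R (\<lambda>x. (\<Prod>l\<in>{1..k}. ?f (x l)) * q ^ m)"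
    unfolding prob_conv_expectation
  proof (intro expectation_mono_finite finR)
    fix x
    show "of_bool (real k < 2 * rows_count k P x) \<le> (\<Prod>l\<in>{1..k}. ?f (x l)) * q ^ m"
    proof (cases "real k < 2 * rows_count k P x")
      case True
      hence "m \<le> card {l\<in>{1..k}. P (x l)}" using k unfolding cnt by linarith
      hence "(1 / q) ^ m \<le> (\<Prod>l\<in>{1..k}. ?f (x l))"
        unfolding prod_eq[OF finite_atLeastAtMost] using q by (intro power_increasing) auto
      hence "(1 / q) ^ m * q ^ m \<le> (\<Prod>l\<in>{1..k}. ?f (x l)) * q ^ m"
        using q by (intro mult_right_mono) auto
      thus ?thesis using True q by (simp add: power_divide)
    qed (use q in \<open>auto intro!: mult_nonneg_nonneg prod_nonneg\<close>)
  qed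
  also have "\<dots> = (E D ?f) ^ k * q ^ m"
    using fin q
    by (simp add: expectation_prod_Pi_pmf[where f = "\<lambda>_. ?f"] integrable_measure_pmf_finite)
  also have "\<dots> \<le> 2 ^ k * q ^ m"
  proof -
    have "E D ?f = E D (\<lambda>y. 1 + of_bool (P y) * (1 / q - 1))"
      by (intro arg_cong[of _ _ "E D"]) auto
    also have "\<dots> = 1 + ?p * (1 / q - 1)"
      unfolding prob_conv_expectation using fin by (subst expectation_finite_linear) simp_all
    also have "\<dots> \<le> 1 + q * (1 / q - 1)"
      using p q by (intro add_left_mono mult_right_mono) auto
    also have "\<dots> \<le> 2" using q by (simp add: algebra_simps)
    finally have "E D ?f \<le> 2" .
    moreover have "0 \<le> E D ?f" using q by (intro Bochner_Integration.integral_nonneg) auto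
    ultimately show ?thesis using q by (intro mult_right_mono power_mono) auto
  qed
  also have "\<dots> \<le> 2 ^ (2 * m) * q ^ m" using k q by (intro mult_right_mono power_increasing) auto
  also have "\<dots> = (4 * q) ^ m" by (simp add: power_mult power_mult_distrib)
  finally show ?thesis .
qed

lemma prob_symmetric:
  assumes "map_pmf uminus D = D"
  shows "Pr D {x. x < - t} = Pr D {x :: real. t < x}"
proof -
  have "Pr D {x. x < - t} = Pr (map_pmf uminus D) {x. x < - t}" by (simp only: assms)
  also have "\<dots> = Pr D {x. t < x}" by (simp add: vimage_def)
  finally show ?thesis .
qed

lemma prob_abs_symmetric:
  assumes fin: "finite (set_pmf D)" and sym: "map_pmf uminus D = D" and t: "0 \<le> t"
  shows "Pr D {x. t < \<bar>x\<bar>} = 2 * Pr D {x :: real. t < x}"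
    and "Pr D {x. t < x} = 1 / 2 - Pr D {x. \<bar>x\<bar> \<le> t} / 2"
proof -
  have "Pr D {x. t < \<bar>x\<bar>} = E D (\<lambda>x. of_bool (t < x) + of_bool (x < - t))"
    unfolding prob_conv_expectation using t by (intro arg_cong[of _ _ "E D"]) (auto simp: abs_if)
  also have "\<dots> = Pr D {x. t < x} + Pr D {x. x < - t}"
    by (simp only: expectation_finite_linear[OF fin] prob_conv_expectation)
  finally show 1: "Pr D {x. t < \<bar>x\<bar>} = 2 * Pr D {x. t < x}"
    by (simp add: prob_symmetric[OF sym])
  have "Pr D {x. \<bar>x\<bar> \<le> t} = 1 - Pr D {x. t < \<bar>x\<bar>}"
    by (subst measure_pmf.prob_compl[symmetric]) (auto intro!: arg_cong[of _ _ "Pr D"])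
  thus "Pr D {x. t < x} = 1 / 2 - Pr D {x. \<bar>x\<bar> \<le> t} / 2" using 1 by linarith
qed

text \<open>Three ranges of \<open>t\<close>. For \<open>t \<le> q\<close> the small-ball bound
  gives the gap \<open>t / (896 * q)\<close> below 1/2; up to \<open>48 * q\<close> the gap stays at
  least 1/896, whence 43008 = 48 * 896. Beyond that the tail bound enters the exponential estimate.
  A general \<open>P\<close> covers both sides of the median.\<close>

lemma prob_majority_le:
  assumes fin: "finite (set_pmf D)" and k: "odd k" "3 \<le> k" and q: "0 < q" and t: "0 < t"
    and small: "\<And>t. 0 < t \<Longrightarrow> t \<le> q \<Longrightarrow> t / (448 * q) \<le> Pr D {x :: real. \<bar>x\<bar> \<le> t}"
    and tail: "Pr D {x. t < \<bar>x\<bar>} \<le> 3 * q / t"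
    and half: "Pr D {x. P x} = 1 / 2 - Pr D {x. \<bar>x\<bar> \<le> t} / 2"
  shows "Pr (Pi_pmf {1..k} d (\<lambda>_. D)) {x. k < 2 * rows_count k P x} \<le> 43008\<^sup>2 * (q / sqrt k)\<^sup>2 / t\<^sup>2"
proof -
  let ?Z = "Pr (Pi_pmf {1..k} d (\<lambda>_. D)) {x. k < 2 * rows_count k P x}"
  have sq: "(q / sqrt k)\<^sup>2 = q\<^sup>2 / k" by (simp add: power_divide)
  have k0: "0 < real k" using k by simp
  consider "t \<le> q" | "q < t" "t \<le> 48 * q" | "48 * q < t" by linarith
  thus ?thesis
  proof cases
    case 1
    have "?Z \<le> 1 / (k * (t / (896 * q))\<^sup>2)"
      using small[OF t 1] half q t k by (intro prob_majority_Chebyshev fin) auto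
    also have "\<dots> = 896\<^sup>2 * (q\<^sup>2 / k) / t\<^sup>2" using q t k0 by (simp add: field_simps)
    also have "\<dots> \<le> 43008\<^sup>2 * (q\<^sup>2 / k) / t\<^sup>2" by (intro divide_right_mono mult_right_mono) auto
    finally show ?thesis unfolding sq .
  next
    case 2
    have "1 / 448 \<le> Pr D {x. \<bar>x\<bar> \<le> q}" using small[of q] q by simp
    also have "\<dots> \<le> Pr D {x. \<bar>x\<bar> \<le> t}" using 2 by (intro prob_mono_pmf) auto
    finally have "?Z \<le> 1 / (k * (1 / 896)\<^sup>2)"
      using half q t k by (intro prob_majority_Chebyshev fin) auto
    also have "\<dots> = 896\<^sup>2 * (1 / k)" using k0 by (simp add: field_simps)
    also have "\<dots> \<le> 43008\<^sup>2 * (q\<^sup>2 / k) / t\<^sup>2"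
    proof -
      have "t\<^sup>2 \<le> (48 * q)\<^sup>2" using 2 t by (intro power_mono) auto
      thus ?thesis using k0 t by (simp add: field_simps)
    qed
    finally show ?thesis unfolding sq .
  next
    case 3
    obtain m' where m': "k = 2 * m' + 1" using k by (auto elim: oddE)
    \<comment> \<open>As \<open>k \<ge> 3\<close>, a majority has \<open>r + 2\<close> rows with
      \<open>r \<ge> 0\<close>. Two of the factors \<open>12 * q / t\<close> supply the decay in
      \<open>t\<close>, and the other \<open>r\<close>, each at most 1/4, supply the decay in
      \<open>k\<close>.\<close>
    then obtain r where r: "k + 1 = 2 * (r + 2)" using k(2) by (intro that[of "m' - 1"]) auto
    have "Pr D {x. P x} = Pr D {x. t < \<bar>x\<bar>} / 2"
    proof -
      have "Pr D {x. \<bar>x\<bar> \<le> t} = 1 - Pr D {x. t < \<bar>x\<bar>}"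
        by (subst measure_pmf.prob_compl[symmetric]) (auto intro!: arg_cong[of _ _ "Pr D"])
      thus ?thesis using half by linarith
    qed
    hence p: "Pr D {x. P x} \<le> 3 * q / t"
      using tail measure_nonneg[of D "{x. t < \<bar>x\<bar>}"] by linarith
    have q16: "4 * (3 * q / t) \<le> 1 / 4" using 3 q t by (simp add: field_simps)
    have "?Z \<le> (4 * (3 * q / t)) ^ (r + 2)"
      using p q t q16 r by (intro prob_majority_exponential fin) auto
    also have "\<dots> \<le> (1 / 4) ^ r * (4 * (3 * q / t))\<^sup>2"
      using q t q16 unfolding power_add by (intro mult_right_mono power_mono) auto
    also have "\<dots> = 144 * (1 / 4 ^ r) * q\<^sup>2 / t\<^sup>2" by (simp add: power_divide power_mult_distrib)
    also have "\<dots> \<le> 144 * (3 / k) * q\<^sup>2 / t\<^sup>2"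
    proof -
      have "2 * r + 3 \<le> 3 * 4 ^ r" by (induction r) auto
      hence "real (2 * r + 3) \<le> real (3 * 4 ^ r)" by (simp only: of_nat_le_iff)
      hence "real k \<le> 3 * 4 ^ r" using r by simp
      hence "1 / 4 ^ r \<le> 3 / real k" using k0 by (simp add: field_simps)
      thus ?thesis by (intro divide_right_mono mult_right_mono mult_left_mono) auto
    qed
    also have "\<dots> = 432 * (q\<^sup>2 / k) / t\<^sup>2" by simp
    also have "\<dots> \<le> 43008\<^sup>2 * (q\<^sup>2 / k) / t\<^sup>2" by (intro divide_right_mono mult_right_mono) auto
    finally show ?thesis unfolding sq .
  qed
qed

text \<open>The median leaves \<open>[-t, t]\<close> only if a strict majority lies beyond
  \<open>t\<close> on one side. The two one-sided bounds give a square tail at scale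
  \<open>q / sqrt k\<close>.\<close>

lemma expectation_med_le:
  assumes fin: "finite (set_pmf D)" and sym: "map_pmf uminus D = D"
    and k: "odd k" "3 \<le> k" and q: "0 < q"
    and small: "\<And>t. 0 < t \<Longrightarrow> t \<le> q \<Longrightarrow> t / (448 * q) \<le> Pr D {x :: real. \<bar>x\<bar> \<le> t}"
    and tail: "\<And>t. 0 < t \<Longrightarrow> Pr D {x. t < \<bar>x\<bar>} \<le> 3 * q / t"
  shows "E (Pi_pmf {1..k} d (\<lambda>_. D)) (\<lambda>x. \<bar>med k x\<bar>) \<le> (1 + 4 * 43008\<^sup>2) * (q / sqrt k)"
proof -
  let ?R = "Pi_pmf {1..k} d (\<lambda>_. D)"
  have "E ?R (\<lambda>x. \<bar>med k x\<bar>) \<le> (1 + 2 * (2 * 43008\<^sup>2)) * (q / sqrt k)"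
  proof (rule expectation_le_of_square_tail)
    fix t :: real assume t: "0 < t"
    have half: "Pr D {x. t < x} = 1 / 2 - Pr D {x. \<bar>x\<bar> \<le> t} / 2"
      using prob_abs_symmetric(2)[OF fin sym] t by simp
    have "Pr ?R {x. t < \<bar>med k x\<bar>} \<le> Pr ?R {x. k < 2 * rows_count k (\<lambda>y. t < y) x \<or> k < 2 * rows_count k (\<lambda>y. y < - t) x}"
    proof (intro prob_mono_pmf)
      fix x assume "t < \<bar>med k x\<bar>"
      hence "t < med k x \<or> med k x < - t" by linarith
      thus "k < 2 * rows_count k (\<lambda>y. t < y) x \<or> k < 2 * rows_count k (\<lambda>y. y < - t) x"
        by (simp only: med_less_iff[OF k(1)])
    qed
    also have "\<dots> \<le> Pr ?R {x. k < 2 * rows_count k (\<lambda>y. t < y) x} + Pr ?R {x. k < 2 * rows_count k (\<lambda>y. y < - t) x}"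
      by (rule prob_disj_le)
    also have "\<dots> \<le> 43008\<^sup>2 * (q / sqrt k)\<^sup>2 / t\<^sup>2 + 43008\<^sup>2 * (q / sqrt k)\<^sup>2 / t\<^sup>2"
      using half prob_symmetric[OF sym, of t]
      by (intro add_mono prob_majority_le fin k q t small tail) auto
    finally show "Pr ?R {x. t < \<bar>med k x\<bar>} \<le> 2 * 43008\<^sup>2 * (q / sqrt k)\<^sup>2 / t\<^sup>2" by simp
  qed (use fin k q in \<open>auto simp: finite_set_Pi_pmf\<close>)
  thus ?thesis by simp
qed

section \<open>Lower bounds for the median\<close>

lemma expectation_abs_ge:
  fixes f :: "'a \<Rightarrow> real"
  assumes "finite (set_pmf p)" "0 \<le> t"
  shows "t * Pr p {x. t < \<bar>f x\<bar>} \<le> E p (\<lambda>x. \<bar>f x\<bar>)"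
proof -
  have "t * Pr p {x. t < \<bar>f x\<bar>} = E p (\<lambda>x. t * of_bool (t < \<bar>f x\<bar>))"
    by (simp add: prob_conv_expectation)
  also have "\<dots> \<le> E p (\<lambda>x. \<bar>f x\<bar>)" using assms by (intro expectation_mono_finite) auto
  finally show ?thesis .
qed

text \<open>All rows are forced above \<open>t\<close>; the loss is exponential in \<open>k\<close>,
  which is affordable for bounded \<open>k\<close>.\<close>

lemma prob_med_gt_ge_power:
  assumes k: "odd k"
  shows "Pr D {x. t < x} ^ k \<le> Pr (Pi_pmf {1..k} d (\<lambda>_. D)) {x. t < med k x}"
proof -
  let ?R = "Pi_pmf {1..k} d (\<lambda>_. D)"
  have "Pr D {x. t < x} ^ k = Pr ?R (Pi {1..k} (\<lambda>_. {x. t < x}))"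
    by (subst measure_Pi_pmf_Pi) simp_all
  also have "Pi {1..k} (\<lambda>_. {x. t < x}) = {x. \<forall>l\<in>{1..k}. t < x l}" by (auto simp: Pi_def)
  also have "Pr ?R {x. \<forall>l\<in>{1..k}. t < x l} \<le> Pr ?R {x. t < med k x}"
  proof (intro prob_mono_pmf)
    fix x assume *: "\<forall>l\<in>{1..k}. t < x l"
    have "0 < k" using k by (cases k) auto
    moreover have "rows_count k (\<lambda>y. t < y) x = k" using * by (simp add: rows_count_def)
    ultimately show "t < med k x" using med_less_iff(1)[OF k] by simp
  qed
  finally show ?thesis .
qed

text \<open>
  With \<open>S\<close> the sum of the signs of the rows above \<open>t\<close> in absolute value and \<open>Z\<close> the number of the other
  rows, the median leaves \<open>[-t, t]\<close> iff \<open>\<bar>S\<bar> > Z\<close>. A Paley-Zygmund argument with the fourth moment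
  makes \<open>\<bar>S\<bar>\<close> large, and Markov's inequality makes \<open>Z\<close> small.
\<close>
lemma prob_abs_med_ge:
  assumes fin: "finite (set_pmf D)" and sym: "map_pmf uminus D = D"
    and k: "odd k" and t: "0 \<le> t" and p: "Pr D {x. \<bar>x\<bar> \<le> t} \<le> 1 / (48 * sqrt k)"
  shows "1 / 8 \<le> Pr (Pi_pmf {1..k} d (\<lambda>_. D)) {x. t < \<bar>med k x\<bar>}"
proof -
  let ?R = "Pi_pmf {1..k} d (\<lambda>_. D)" and ?p = "Pr D {x. \<bar>x\<bar> \<le> t}"
  have finR: "finite (set_pmf ?R)" using fin by (simp add: finite_set_Pi_pmf)
  have k1: "1 \<le> real k" using k by (cases k) auto
  hence sk: "1 \<le> sqrt k" by simp
  define g where "g = (\<lambda>y :: real. of_bool (t < y) - of_bool (y < - t) :: real)"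
  define S where "S = (\<lambda>x. \<Sum>l\<in>{1..k}. g (x l))"
  define Z where "Z = rows_count k (\<lambda>y. \<bar>y\<bar> \<le> t)"
  have g3: "g y ^ 3 = g y" "\<bar>g y\<bar> \<le> 1" "(g y)\<^sup>2 = 1 - of_bool (\<bar>y\<bar> \<le> t)" for y
    using t by (auto simp: g_def)
  have g0: "E D g = 0"
    using prob_symmetric[OF sym, of t]
    by (simp only: g_def expectation_finite_linear[OF fin] prob_conv_expectation[symmetric])
  have "E ?R (\<lambda>x. (S x)\<^sup>2) = (\<Sum>l\<in>{1..k}. E D (\<lambda>y. (g y)\<^sup>2))"
    unfolding S_def using fin g0 by (intro expectation_sum_square_Pi[where g = "\<lambda>_. g"]) auto
  also have "\<dots> = k * (1 - ?p)"
    by (simp add: g3 expectation_finite_linear fin prob_conv_expectation)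
  finally have S2: "E ?R (\<lambda>x. (S x)\<^sup>2) = k * (1 - ?p)" .
  have S4: "E ?R (\<lambda>x. (S x) ^ 4) \<le> 3 * (real k)\<^sup>2"
    using expectation_sum_fourth_Pi[of "{1..k}" "\<lambda>_. D" "\<lambda>_. g" d] fin g0 g3 by (simp add: S_def)
  have "k * (47 / 48) \<le> k * (1 - ?p)"
  proof -
    have "1 / (48 * sqrt k) \<le> 1 / 48" using sk by (simp add: field_simps)
    hence "?p \<le> 1 / 48" using p by linarith
    thus ?thesis by (intro mult_left_mono) auto
  qed
  also have "\<dots> = E ?R (\<lambda>x. (S x)\<^sup>2)" by (rule S2[symmetric])
  \<comment> \<open>For large \<open>\<bar>S x\<bar>\<close> the bound is
    \<open>(S^2 - 4 k)^2 \<ge> 0\<close> rearranged, for small it is \<open>S^2 \<le> k / 4\<close>.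
    Taking expectations, \<open>47/48 \<le> 1/4 + 3/8 + 2 p\<close>, where \<open>p\<close> is the
    probability of the large case, so \<open>p \<ge> 1/6\<close>.\<close>
  also have "\<dots> \<le> E ?R (\<lambda>x. k / 4 + ((S x) ^ 4 / (8 * k) + 2 * k * of_bool (sqrt k / 2 \<le> \<bar>S x\<bar>)))"
  proof (intro expectation_mono_finite finR)
    fix x
    show "(S x)\<^sup>2 \<le> k / 4 + ((S x) ^ 4 / (8 * k) + 2 * k * of_bool (sqrt k / 2 \<le> \<bar>S x\<bar>))"
    proof (cases "sqrt k / 2 \<le> \<bar>S x\<bar>")
      case True
      have "0 \<le> ((S x)\<^sup>2 - 4 * k)\<^sup>2" by simp
      hence "8 * k * (S x)\<^sup>2 \<le> (S x) ^ 4 + 16 * (real k)\<^sup>2"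
        by (simp add: power2_diff algebra_simps flip: power_mult)
      hence "(S x)\<^sup>2 \<le> (S x) ^ 4 / (8 * k) + 2 * k"
        using k1 by (simp add: field_simps power2_eq_square)
      thus ?thesis using True by simp
    next
      case False
      hence "\<bar>S x\<bar>\<^sup>2 \<le> (sqrt k / 2)\<^sup>2" by (intro power_mono) auto
      hence "(S x)\<^sup>2 \<le> k / 4" by (simp add: power_divide)
      thus ?thesis by (simp add: add_increasing2)
    qed
  qed
  also have "\<dots> = k / 4 + (E ?R (\<lambda>x. (S x) ^ 4) / (8 * k) + 2 * k * Pr ?R {x. sqrt k / 2 \<le> \<bar>S x\<bar>})"
    unfolding expectation_finite_linear[OF finR] prob_conv_expectation by simp
  also have "\<dots> \<le> k / 4 + (3 * (real k)\<^sup>2 / (8 * k) + 2 * k * Pr ?R {x. sqrt k / 2 \<le> \<bar>S x\<bar>})"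
    using S4 by (intro add_left_mono add_right_mono divide_right_mono) auto
  also have "\<dots> = k * (5 / 8 + 2 * Pr ?R {x. sqrt k / 2 \<le> \<bar>S x\<bar>})"
    using k1 by (simp add: field_simps power2_eq_square)
  finally have A: "1 / 6 \<le> Pr ?R {x. sqrt k / 2 \<le> \<bar>S x\<bar>}"
    using k1 by simp
  have "Pr ?R {x. sqrt k / 2 \<le> Z x} \<le> E ?R Z / (sqrt k / 2)"
    using k1 by (intro Markov_pmf finR) (auto simp: Z_def rows_count_def intro!: sum_nonneg)
  also have "\<dots> = k * ?p / (sqrt k / 2)" unfolding Z_def expectation_rows_count[OF fin] ..
  also have "\<dots> \<le> k * (1 / (48 * sqrt k)) / (sqrt k / 2)"
    using p by (intro divide_right_mono mult_left_mono) auto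
  also have "\<dots> = 1 / 24" using k1 by (simp add: field_simps)
  finally have Zle: "Pr ?R {x. sqrt k / 2 \<le> Z x} \<le> 1 / 24" .
  have "Pr ?R {x. sqrt k / 2 \<le> \<bar>S x\<bar>} \<le> Pr ?R {x. t < \<bar>med k x\<bar> \<or> sqrt k / 2 \<le> Z x}"
  proof (intro prob_mono_pmf)
    fix x assume Sx: "sqrt k / 2 \<le> \<bar>S x\<bar>"
    show "t < \<bar>med k x\<bar> \<or> sqrt k / 2 \<le> Z x"
    proof (rule disjCI)
      assume "\<not> sqrt k / 2 \<le> Z x"
      hence SZ: "Z x < \<bar>S x\<bar>" using Sx by linarith
      have S_eq: "S x = rows_count k (\<lambda>y. t < y) x - rows_count k (\<lambda>y. y < - t) x"
        by (simp add: S_def g_def rows_count_def sum_subtractf)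
      have "rows_count k (\<lambda>y. t < y) x + rows_count k (\<lambda>y. y < - t) x + Z x = (\<Sum>l\<in>{1..k}. 1)"
        unfolding Z_def rows_count_def sum.distrib[symmetric] using t by (intro sum.cong) auto
      hence "rows_count k (\<lambda>y. t < y) x + rows_count k (\<lambda>y. y < - t) x + Z x = k" by simp
      \<comment> \<open>Rows above, rows below and \<open>Z x\<close> add up to \<open>k\<close>. As
        the two sides differ by more than \<open>Z x\<close>, the larger one is a strict
        majority.\<close>
      hence "real k < 2 * rows_count k (\<lambda>y. t < y) x \<or> real k < 2 * rows_count k (\<lambda>y. y < - t) x"
        using SZ S_eq by linarith
      hence "t < med k x \<or> med k x < - t" by (simp only: med_less_iff[OF k])
      thus "t < \<bar>med k x\<bar>" by linarith
    qed
  qed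
  also have "\<dots> \<le> Pr ?R {x. t < \<bar>med k x\<bar>} + Pr ?R {x. sqrt k / 2 \<le> Z x}"
    by (rule prob_disj_le)
  finally show ?thesis using A Zle by linarith
qed

section \<open>The two bounds\<close>

text \<open>One of the items \<open>j \<le> B\<close>, each of size at least \<open>1 / B\<close>,
  collides with constant probability. Removing \<open>i\<close> leaves at least \<open>B - 1\<close>
  of them. Symmetry halves the resulting 1/5.\<close>

lemma noise_prob_gt_half_reciprocal:
  fixes B :: nat
  assumes J: "finite J" "J = {1..n} - {i}" and B: "3 \<le> B" "B \<le> n"
  shows "1 / 10 \<le> Pr (noise_pmf (1 / B) J) {x. 1 / (2 * B) < x}"
proof -
  let ?q = "1 / real B"
  define A where "A = {1..B} - {i}"
  have JA: "J = A \<union> (J - A)" using J B by (auto simp: A_def)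
  have cA: "B - 1 \<le> card A" using card_Diff1_le[of "{1..B}" i] by (simp add: A_def card_Diff_singleton_if)
  have "(1 - ?q) ^ card A \<le> (1 - ?q) ^ (B - 1)"
    using cA B by (intro power_decreasing) auto
  \<comment> \<open>From \<open>(1 - q)(1 + q) \<le> 1\<close> and Bernoulli's inequality
    \<open>(1 + q)^(B - 1) \<ge> 2 - 1 / B \<ge> 5 / 3\<close>, with
    \<open>q = 1 / B\<close>.\<close>
  also have "\<dots> \<le> 3 / 5"
  proof -
    have "5 / 3 \<le> 1 + real (B - 1) * ?q" using B by (simp add: field_simps of_nat_diff)
    also have "\<dots> \<le> (1 + ?q) ^ (B - 1)" using B by (intro Bernoulli_inequality) (simp add: order.trans[of _ 0])
    finally have "(1 - ?q) ^ (B - 1) * (5 / 3) \<le> (1 - ?q) ^ (B - 1) * (1 + ?q) ^ (B - 1)"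
      using B by (intro mult_left_mono) auto
    also have "\<dots> = (1 - ?q\<^sup>2) ^ (B - 1)"
      by (simp add: power_mult_distrib[symmetric] algebra_simps power2_eq_square)
    also have "\<dots> \<le> 1" using B by (intro power_le_one) (auto simp: power_le_one)
    finally show ?thesis by simp
  qed
  finally have "1 / 5 \<le> (1 - (1 - ?q) ^ card A) / 2" by simp
  also have "\<dots> \<le> Pr (noise_pmf ?q (A \<union> (J - A))) {x. ?q \<le> \<bar>x\<bar>}"
    using J B by (intro noise_far) (auto simp: A_def field_simps)
  also have "\<dots> = Pr (noise_pmf ?q J) {x. ?q \<le> \<bar>x\<bar>}" by (simp only: JA[symmetric])
  also have "\<dots> \<le> Pr (noise_pmf ?q J) {x. 1 / (2 * B) < \<bar>x\<bar>}"
  proof (intro prob_mono_pmf)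
    fix x assume "?q \<le> \<bar>x\<bar>"
    moreover have "1 / (2 * real B) < ?q" using B by (simp add: field_simps)
    ultimately show "1 / (2 * B) < \<bar>x\<bar>" by linarith
  qed
  also have "\<dots> = 2 * Pr (noise_pmf ?q J) {x. 1 / (2 * B) < x}"
    using J by (intro prob_abs_symmetric map_uminus_noise_pmf) auto
  finally show ?thesis by simp
qed

text \<open>The concentration bound is used with \<open>m\<close> about \<open>ln k\<close> and a
  block of about \<open>N = 4 B m\<close> items, hence about \<open>4 m\<close> expected collisions:
  \<open>2 ^ m * exp (1 / 2 - 2 m)\<close> is still \<open>O(1 / k)\<close>. Dividing by
  \<open>m\<close> leaves a term in \<open>t\<close> that is linear in \<open>ln k\<close>.\<close>

lemma noise_prob_le_large:
  fixes B k :: nat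
  assumes J: "J = {1..n} - {i}" and n: "k * B \<le> n" and kB: "k \<le> B" and k: "384\<^sup>2 \<le> k"
  shows "Pr (noise_pmf (1 / B) J) {x. \<bar>x\<bar> \<le> 1 / (49152 * (B * sqrt k * ln k))} \<le> 1 / (48 * sqrt k)"
proof -
  let ?t = "1 / (49152 * (B * sqrt k * ln k))"
  have k3: "3 \<le> real k" "0 < real k" and B3: "3 \<le> B" "0 < real B" using k kB by auto
  have "sqrt (384\<^sup>2) \<le> sqrt (real k)" using k by (intro real_sqrt_le_mono) simp
  hence sk: "384 \<le> sqrt k" by simp
  have skk: "sqrt k * sqrt k = k" by simp
  have ln1: "1 \<le> ln (real k)"
  proof -
    have "exp 1 \<le> real k" using exp_le k3(1) by linarith
    thus ?thesis using k3 by (simp add: ln_ge_iff)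
  qed
  define m where "m = nat \<lceil>ln (real k)\<rceil>"
  have m: "ln k \<le> m" "real m \<le> 2 * ln k" "1 \<le> m"
  proof -
    have "real m = \<lceil>ln (real k)\<rceil>" using ln1 by (simp add: m_def)
    thus "ln k \<le> m" "real m \<le> 2 * ln k" using ln1 by linarith+
    thus "1 \<le> m" using ln1 by linarith
  qed
  define N where "N = B * (4 * m)"
  define K where "K = {N + 1..2 * N} - {i}"
  \<comment> \<open>This keeps the block \<open>(N, 2 N]\<close> inside \<open>{1..n}\<close>, since
    \<open>2 N = 8 m B \<le> k B \<le> n\<close>.\<close>
  have "8 * m \<le> k"
  proof -
    have "ln (real k) = 2 * ln (sqrt k)" using k3 by (simp add: ln_sqrt)
    also have "\<dots> \<le> 2 * (sqrt k - 1)" using sk k3 by (intro mult_left_mono ln_le_minus_one) auto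
    finally have "8 * real m \<le> 32 * sqrt k" using m(2) by argo
    also have "\<dots> \<le> sqrt k * sqrt k" using sk by (intro mult_right_mono) auto
    finally show ?thesis unfolding skk by linarith
  qed
  hence N_le: "2 * N \<le> k * B" unfolding N_def by (simp add: mult.commute)
  have N: "2 * N \<le> n" "1 \<le> N" using order.trans[OF N_le n] m B3 by (simp_all add: N_def)
  have cK: "real N - 1 \<le> card K"
    using card_Diff1_le[of "{N + 1..2 * N}" i] N by (simp add: K_def card_Diff_singleton_if)
  have t0: "0 \<le> ?t" using ln1 by simp
  have "Pr (noise_pmf (1 / B) J) {x. \<bar>x\<bar> \<le> ?t} \<le>
      2 ^ m * exp (- (1 / B) * card K / 2) + 2 * (1 / B) * (1 + 8 * (real N)\<^sup>2 * ?t) / m"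
    using N m B3 t0 by (intro noise_concentration_le[where K = K]) (auto simp: K_def J)
  also have "2 ^ m * exp (- (1 / B) * card K / 2) \<le> 2 / k"
  proof -
    have "real N / B - 1 \<le> card K / B"
    proof -
      have "(real N - 1) / B \<le> card K / B" using cK by (intro divide_right_mono) auto
      moreover have "1 / real B \<le> 1" using B3 by simp
      ultimately show ?thesis by (simp add: diff_divide_distrib)
    qed
    hence "- (1 / B) * card K / 2 \<le> 1 / 2 - 2 * m" using B3 by (simp add: N_def)
    hence "2 ^ m * exp (- (1 / B) * card K / 2) \<le> exp 1 ^ m * exp (1 / 2 - 2 * real m)"
      using exp_ge_add_one_self[of 1] by (intro mult_mono power_mono) auto
    also have "\<dots> = exp (1 / 2) * exp (- real m)" by (simp flip: exp_of_nat_mult exp_add)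
    also have "\<dots> \<le> 2 * exp (- ln k)"
    proof (intro mult_mono)
      have "(exp (1 / 2 :: real))\<^sup>2 \<le> 2\<^sup>2" using exp_le by (simp flip: exp_of_nat_mult)
      thus "exp (1 / 2 :: real) \<le> 2" by (rule power2_le_imp_le) simp
    qed (use m in auto)
    also have "\<dots> = 2 / k" using k3 by (simp add: exp_minus inverse_eq_divide)
    finally show ?thesis .
  qed
  also have "2 * (1 / B) * (1 + 8 * (real N)\<^sup>2 * ?t) / m = 2 / (B * m) + 256 * (B * m) * ?t"
    using B3 m by (simp add: N_def power2_eq_square field_simps)
  \<comment> \<open>Here \<open>m \<le> 2 * ln k\<close>, and 49152 = 256 * 2 * 96.\<close>
  also have "256 * (B * m) * ?t \<le> 1 / (96 * sqrt k)"
  proof -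
    have "256 * (real B * m) * ?t \<le> 256 * (real B * (2 * ln k)) * ?t"
      using m t0 by (intro mult_left_mono mult_right_mono) auto
    also have "\<dots> = 1 / (96 * sqrt k)" using B3 ln1 k3 by (simp add: field_simps)
    finally show ?thesis by simp
  qed
  also have "2 / (B * m) \<le> 2 / real k"
  proof -
    have "k * 1 \<le> B * m" using kB m by (intro mult_mono) auto
    hence "real k \<le> B * m" by (simp only: of_nat_le_iff mult_1_right)
    thus ?thesis using k3 by (intro divide_left_mono) auto
  qed
  \<comment> \<open>The threshold \<open>384^2\<close> on \<open>k\<close> makes
    \<open>4 / k \<le> 1 / (96 * sqrt k)\<close>, half of the allowance; the term in
    \<open>t\<close> takes the other half.\<close>
  also have "2 / real k + (2 / k + 1 / (96 * sqrt k)) \<le> 1 / (48 * sqrt k)"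
  proof -
    have "4 / real k = 4 / (sqrt k * sqrt k)" by simp
    also have "\<dots> \<le> 4 / (384 * sqrt k)" using sk k3 by (intro frac_le mult_right_mono) auto
    finally show ?thesis by simp
  qed
  finally show ?thesis by simp
qed

theorem theorem10:
  "\<exists>c > (0::real). \<exists>C > (0::real). \<forall>k n B :: nat.
     odd k \<longrightarrow> 3 \<le> k \<longrightarrow> k * B \<le> n \<longrightarrow> k \<le> B \<longrightarrow>
     (\<forall>i\<in>{1..n}.
        c * (1 / (real B * sqrt (real k) * ln (real k))) \<le> expected_error k n B i \<and>
        expected_error k n B i \<le> C * (1 / (real B * sqrt (real k))))"
proof -
  obtain K0 :: nat where K0: "K0 = 384\<^sup>2" by blast
  \<comment> \<open>The first value serves \<open>k \<ge> K0\<close>, with 393216 = 8 * 49152 from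
    probability 1/8 at the level \<open>t\<close>. The second serves \<open>k < K0\<close>: each of
    the \<open>k\<close> rows exceeds \<open>1 / (2 B)\<close> with probability at least
    1/10.\<close>
  define c where "c = min (1 / 393216) ((1 / 10) ^ K0 / 2 :: real)"
  have c: "0 < c" "c \<le> 1 / 393216" "c \<le> (1 / 10) ^ K0 / 2" by (simp_all add: c_def)
  have "c * (1 / (real B * sqrt k * ln k)) \<le> expected_error k n B i \<and>
      expected_error k n B i \<le> (1 + 4 * 43008\<^sup>2) * (1 / (real B * sqrt k))"
    if k: "odd k" "3 \<le> k" and n: "k * B \<le> n" and kB: "k \<le> B" and i: "i \<in> {1..n}" for k n B i :: nat
  proof -
    define J where "J = {1..n} - {i}"
    let ?q = "1 / real B" and ?D = "noise_pmf (1 / real B) J"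
    let ?R = "Pi_pmf {1..k} 0 (\<lambda>_. ?D)"
    have J: "finite J" "0 \<notin> J" by (auto simp: J_def)
    have B: "3 \<le> B" "0 < real B" using k kB by auto
    have "B \<le> k * B" using k by simp
    with n have Bn: "B \<le> n" by (rule order.trans[rotated])
    have q: "0 < ?q" "?q \<le> 1 / 3" using B by (auto simp: field_simps)
    have fin: "finite (set_pmf ?D)" "finite (set_pmf ?R)" using J by (auto simp: finite_set_Pi_pmf)
    have sym: "map_pmf uminus ?D = ?D" by (rule map_uminus_noise_pmf[OF J(1)])
    have err: "expected_error k n B i = E ?R (\<lambda>x. \<bar>med k x\<bar>)"
      unfolding J_def using i B k by (intro expected_error_eq) auto
    have "E ?R (\<lambda>x. \<bar>med k x\<bar>) \<le> (1 + 4 * 43008\<^sup>2) * (?q / sqrt k)"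
    proof (rule expectation_med_le[OF fin(1) sym k q(1)])
      show "t / (448 * ?q) \<le> Pr ?D {x. \<bar>x\<bar> \<le> t}" if "0 < t" "t \<le> ?q" for t
        using that q by (intro noise_small_ball J)
      show "Pr ?D {x. t < \<bar>x\<bar>} \<le> 3 * ?q / t" if "0 < t" for t
        using that q by (intro noise_tail J) auto
    qed
    moreover have "c * (1 / (real B * sqrt k * ln k)) \<le> E ?R (\<lambda>x. \<bar>med k x\<bar>)"
    proof (cases "K0 \<le> k")
      case True
      let ?t = "1 / (49152 * (B * sqrt k * ln k))"
      have t: "0 \<le> ?t" using k by simp
      have "1 / 8 \<le> Pr ?R {x. t < \<bar>med k x\<bar>}" if "t = ?t" for t
        unfolding that using True K0 by (intro prob_abs_med_ge fin sym k t noise_prob_le_large[OF J_def n kB]) simp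
      hence "?t * (1 / 8) \<le> ?t * Pr ?R {x. ?t < \<bar>med k x\<bar>}" by (intro mult_left_mono t) simp
      also have "\<dots> \<le> E ?R (\<lambda>x. \<bar>med k x\<bar>)" by (rule expectation_abs_ge[OF fin(2) t])
      also have "?t * (1 / 8) = 1 / 393216 * (1 / (real B * sqrt k * ln k))" by simp
      finally show ?thesis
        using c(2) k by (elim order.trans[rotated]) (intro mult_right_mono, auto)
    next
      case False
      let ?s = "1 / (2 * real B)"
      have "c \<le> (1 / 10) ^ k / 2"
      proof -
        have "(1 / 10) ^ K0 \<le> (1 / 10 :: real) ^ k" using False by (intro power_decreasing) auto
        thus ?thesis using c(3) by linarith
      qed
      also have "\<dots> \<le> Pr ?D {x. ?s < x} ^ k / 2"
        using noise_prob_gt_half_reciprocal[OF J(1) J_def B(1) Bn]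
        by (intro divide_right_mono power_mono) auto
      also have "\<dots> \<le> Pr ?R {x. ?s < med k x} / 2"
        by (intro divide_right_mono prob_med_gt_ge_power k) simp
      also have "\<dots> \<le> Pr ?R {x. ?s < \<bar>med k x\<bar>} / 2"
        by (intro divide_right_mono prob_mono_pmf) auto
      finally have "c * (1 / B) \<le> ?s * Pr ?R {x. ?s < \<bar>med k x\<bar>}"
        using B by (simp add: field_simps)
      also have "\<dots> \<le> E ?R (\<lambda>x. \<bar>med k x\<bar>)" by (rule expectation_abs_ge[OF fin(2)]) simp
      finally have "c * (1 / B) \<le> E ?R (\<lambda>x. \<bar>med k x\<bar>)" .
      \<comment> \<open>For \<open>k < K0\<close> the stronger bound of order \<open>1 / B\<close>
        holds, and it suffices because \<open>sqrt k * ln k \<ge> 1\<close>.\<close>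
      moreover have "c * (1 / (real B * sqrt k * ln k)) \<le> c * (1 / B)"
      proof -
        have "exp 1 \<le> real k" using exp_le k(2) by linarith
        hence "1 \<le> ln (real k)" using k by (simp add: ln_ge_iff)
        hence "1 * 1 \<le> sqrt k * ln k" using k by (intro mult_mono) auto
        hence "real B * 1 \<le> real B * (sqrt k * ln k)" by (intro mult_left_mono) auto
        thus ?thesis using c(1) B by (intro mult_left_mono frac_le) (auto simp: mult.assoc)
      qed
      ultimately show ?thesis by linarith
    qed
    ultimately show ?thesis unfolding err by simp
  qed
  thus ?thesis using c(1) by (intro exI[of _ c] conjI exI[of _ "1 + 4 * 43008\<^sup>2"]) auto
qed

end
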